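(* Let $q\in\mathbb{C}\setminus\{0\}$ with $q^2\neq1$, let $[n]_{q^{-2}}=(q^{-2n}-1)/(q^{-2}-1)$, and let $\mathsf{D}=x\partial_x+y\partial_y+\theta\partial_\theta\in{\cal W}_q(2|1)$ be the Euler derivation. (i) If $f_n\in{\cal O}(\mathbb{C}_q^{2|1})$ and $g_n\in{\cal O}(\partial\mathbb{C}_q^{2|1})$ are homogeneous elements of order $n$, then in ${\cal W}_q(2|1)$ $$\mathsf{D}f_n=[n]_{q^{-2}}f_n+q^{-2n}f_n\mathsf{D}\qquad\text{and}\qquad g_n\mathsf{D}=[n]_{q^{-2}}g_n+q^{-2n}\mathsf{D}g_n.$$ (ii) The operator $\mathsf{D}$ acting on ${\cal O}(\mathbb{C}_q^{2|1})$ is a $q^{-2}$-derivative, i.e. $\mathsf{D}(f_nf_k)=\mathsf{D}(f_n)f_k+q^{-2n}f_n\mathsf{D}(f_k)$ for all homogeneous $f_n,f_k\in{\cal O}(\mathbb{C}_q^{2|1})$ of orders $n$ and $k$. (iii) The element $\mathsf{E}=\mathbf{1}+(q^{-2}-1)\mathsf{D}$ is a non-zero normal element of ${\cal W}_q(2|1)$.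
   Context: ${\cal W}_q(2|1)$ is the unital associative $\mathbb{C}$-algebra generated by $x,y,\partial_x,\partial_y$ (even) and $\theta,\partial_\theta$ (odd) with relations (a) $xy=yx$, $x\theta=q\theta x$, $y\theta=q\theta y$, $\theta^2=0$; (b) $\partial_x x=1+q^{-2}x\partial_x$, $\partial_y x=q^{-2}x\partial_y$, $\partial_\theta x=q^{-1}x\partial_\theta$, $\partial_y y=1+q^{-2}y\partial_y+(q^{-2}-1)x\partial_x$, $\partial_x y=y\partial_x$, $\partial_\theta y=q^{-1}y\partial_\theta$, $\partial_\theta\theta=1-\theta\partial_\theta+(q^{-2}-1)(x\partial_x+y\partial_y)$, $\partial_x\theta=q^{-1}\theta\partial_x$, $\partial_y\theta=q^{-1}\theta\partial_y$; (c) $\partial_x\partial_y=q^{-2}\partial_y\partial_x$, $\partial_x\partial_\theta=q^{-1}\partial_\theta\partial_x$, $\partial_y\partial_\theta=q^{-1}\partial_\theta\partial_y$, $\partial_\theta^2=0$. ${\cal O}(\mathbb{C}_q^{2|1})$ is the algebra generated by $x,y,\theta$ with relations (a), and ${\cal O}(\partial\mathbb{C}_q^{2|1})$ the algebra generated by $\partial_x,\partial_y,\partial_\theta$ with relations (c); both are regarded as subalgebras of ${\cal W}_q(2|1)$ (multiplication ${\cal O}(\mathbb{C}_q^{2|1})\otimes{\cal O}(\partial\mathbb{C}_q^{2|1})\to{\cal W}_q(2|1)$ is a vector space isomorphism). "Homogeneous of order $n$" means of total degree $n$ in the generators. ${\cal W}_q(2|1)$ acts on ${\cal O}(\mathbb{C}_q^{2|1})$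 with $x,y,\theta$ acting by left multiplication and $\partial_x,\partial_y,\partial_\theta$ annihilating $\mathbf 1$ and acting through relations (b). An element $e$ of an algebra $W$ is normal if $eW=We$. *)

theory Defs
  imports Complex_Main "HOL-Algebra.QuotRing" "HOL-Library.Poly_Mapping"
begin

section \<open>Algebras given by generators and relations over the complex numbers\<close>

text \<open>
  With concatenation as addition, lists form the free monoid, and the convolution product of
  \<^typ>\<open>'g list \<Rightarrow>\<^sub>0 complex\<close> is the multiplication of noncommutative polynomials in
  the letters \<^typ>\<open>'g\<close>.
\<close>

instantiation list :: (type) monoid_add
begin

definition zero_list :: "'a list" where
  "zero_list = []"

definition plus_list :: "'a list \<Rightarrow> 'a list \<Rightarrow> 'a list" where
  "plus_list = append"

instance
  by standard (simp_all add: zero_list_def plus_list_def)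

end

type_synonym 'g ncpoly = "'g list \<Rightarrow>\<^sub>0 complex"

definition const :: "complex \<Rightarrow> 'g ncpoly" where
  "const c = Poly_Mapping.single [] c"

definition letter :: "'g \<Rightarrow> 'g ncpoly" where
  "letter g = Poly_Mapping.single [g] 1"

definition free_algebra :: "'g set \<Rightarrow> 'g ncpoly ring" where
  "free_algebra S =
     \<lparr>carrier = {p. Poly_Mapping.keys p \<subseteq> lists S}, monoid.mult = (*), one = 1, ring.zero = 0, add = (+)\<rparr>"

lemma ring_free_algebra: "ring (free_algebra S)"
proof (rule ringI)
  show "abelian_group (free_algebra S)"
  proof (rule abelian_groupI)
    fix p assume "p \<in> carrier (free_algebra S)"
    then show "\<exists>r\<in>carrier (free_algebra S). r \<oplus>\<^bsub>free_algebra S\<^esub> p = \<zero>\<^bsub>free_algebra S\<^esub>"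
      by (intro bexI[of _ "- p"]) (auto simp: free_algebra_def)
  next
    fix p r assume "p \<in> carrier (free_algebra S)" "r \<in> carrier (free_algebra S)"
    then show "p \<oplus>\<^bsub>free_algebra S\<^esub> r \<in> carrier (free_algebra S)"
      using keys_add[of p r] by (auto simp: free_algebra_def)
  qed (auto simp: free_algebra_def algebra_simps)
  show "Group.monoid (free_algebra S)"
  proof (rule monoidI)
    fix p r assume "p \<in> carrier (free_algebra S)" "r \<in> carrier (free_algebra S)"
    then show "p \<otimes>\<^bsub>free_algebra S\<^esub> r \<in> carrier (free_algebra S)"
      using keys_mult[of p r] by (fastforce simp: free_algebra_def plus_list_def)
  next
    show "\<one>\<^bsub>free_algebra S\<^esub> \<in> carrier (free_algebra S)"
      by (auto simp: free_algebra_def zero_list_def)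
  qed (auto simp: free_algebra_def algebra_simps)
qed (auto simp: free_algebra_def algebra_simps)

text \<open>
  A relation \<open>l = r\<close> is given as the element \<open>l - r\<close> of \<open>Rel\<close>.
  An ideal of the free algebra is automatically a linear subspace, since it absorbs
  multiplication by the constants \<^term>\<open>const c\<close>.
\<close>

definition relation_ideal :: "'g set \<Rightarrow> 'g ncpoly set \<Rightarrow> 'g ncpoly set" where
  "relation_ideal S Rel = Idl\<^bsub>free_algebra S\<^esub> Rel"

definition presented_algebra :: "'g set \<Rightarrow> 'g ncpoly set \<Rightarrow> 'g ncpoly set ring" where
  "presented_algebra S Rel = free_algebra S Quot relation_ideal S Rel"

definition residue_class :: "'g set \<Rightarrow> 'g ncpoly set \<Rightarrow> 'g ncpoly \<Rightarrow> 'g ncpoly set" where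
  "residue_class S Rel p = relation_ideal S Rel +>\<^bsub>free_algebra S\<^esub> p"

definition homogeneous :: "'g set \<Rightarrow> 'g ncpoly set \<Rightarrow> nat \<Rightarrow> 'g ncpoly set \<Rightarrow> bool" where
  "homogeneous S Rel n f \<longleftrightarrow>
     (\<exists>p\<in>carrier (free_algebra S).
        (\<forall>w\<in>Poly_Mapping.keys p. length w = n) \<and> f = residue_class S Rel p)"

definition normal_element :: "('a, 'b) ring_scheme \<Rightarrow> 'a \<Rightarrow> bool" where
  "normal_element W e \<longleftrightarrow>
     e \<in> carrier W \<and> e <#\<^bsub>W\<^esub> carrier W = carrier W #>\<^bsub>W\<^esub> e"


section \<open>The algebra \<open>W\<^sub>q(2|1)\<close>\<close>

datatype gen = Gx | Gy | Gtheta | Dx | Dy | Dtheta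

abbreviation "coord_gens \<equiv> {Gx, Gy, Gtheta}"
abbreviation "deriv_gens \<equiv> {Dx, Dy, Dtheta}"

definition coord_rels :: "complex \<Rightarrow> gen ncpoly set" where
  "coord_rels q =
    (let x = letter Gx; y = letter Gy; \<theta> = letter Gtheta
     in {x * y - y * x,
         x * \<theta> - const q * \<theta> * x,
         y * \<theta> - const q * \<theta> * y,
         \<theta> * \<theta>})"

definition cross_rels :: "complex \<Rightarrow> gen ncpoly set" where
  "cross_rels q =
    (let x = letter Gx; y = letter Gy; \<theta> = letter Gtheta;
         dx = letter Dx; dy = letter Dy; d\<theta> = letter Dtheta;
         q1 = const (q powi (-1)); q2 = const (q powi (-2)); c = const (q powi (-2) - 1)
     in {dx * x - (1 + q2 * x * dx),
         dy * x - q2 * x * dy,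
         d\<theta> * x - q1 * x * d\<theta>,
         dy * y - (1 + q2 * y * dy + c * x * dx),
         dx * y - y * dx,
         d\<theta> * y - q1 * y * d\<theta>,
         d\<theta> * \<theta> - (1 - \<theta> * d\<theta> + c * (x * dx + y * dy)),
         dx * \<theta> - q1 * \<theta> * dx,
         dy * \<theta> - q1 * \<theta> * dy})"

definition deriv_rels :: "complex \<Rightarrow> gen ncpoly set" where
  "deriv_rels q =
    (let dx = letter Dx; dy = letter Dy; d\<theta> = letter Dtheta;
         q1 = const (q powi (-1)); q2 = const (q powi (-2))
     in {dx * dy - q2 * dy * dx,
         dx * d\<theta> - q1 * d\<theta> * dx,
         dy * d\<theta> - q1 * d\<theta> * dy,
         d\<theta> * d\<theta>})"

definition weyl_rels :: "complex \<Rightarrow> gen ncpoly set" where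
  "weyl_rels q = coord_rels q \<union> cross_rels q \<union> deriv_rels q"

abbreviation weyl_algebra :: "complex \<Rightarrow> gen ncpoly set ring" where
  "weyl_algebra q \<equiv> presented_algebra UNIV (weyl_rels q)"

abbreviation coord_algebra :: "complex \<Rightarrow> gen ncpoly set ring" where
  "coord_algebra q \<equiv> presented_algebra coord_gens (coord_rels q)"

abbreviation deriv_algebra :: "complex \<Rightarrow> gen ncpoly set ring" where
  "deriv_algebra q \<equiv> presented_algebra deriv_gens (deriv_rels q)"

abbreviation in_weyl :: "complex \<Rightarrow> gen ncpoly \<Rightarrow> gen ncpoly set" where
  "in_weyl q \<equiv> residue_class UNIV (weyl_rels q)"

abbreviation in_coord :: "complex \<Rightarrow> gen ncpoly \<Rightarrow> gen ncpoly set" where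
  "in_coord q \<equiv> residue_class coord_gens (coord_rels q)"

text \<open>
  The canonical maps of \<^term>\<open>coord_algebra q\<close> and \<^term>\<open>deriv_algebra q\<close> to
  \<^term>\<open>weyl_algebra q\<close>.  All representatives of a class \<open>f\<close> of either algebra lie in
  one and the same class of the target, so the union is that single class.
\<close>

definition weyl_embed :: "complex \<Rightarrow> gen ncpoly set \<Rightarrow> gen ncpoly set" where
  "weyl_embed q f = (\<Union>p\<in>f. in_weyl q p)"

text \<open>
  Only the effect of the derivatives on \<open>1\<close> is prescribed; because \<open>\<rho>\<close> is
  multiplicative in its first argument, the cross relations determine the rest.
  Values outside the carriers are fixed by extensionality, so that the action is unique as a
  function.
\<close>

definition is_weyl_action ::
    "complex \<Rightarrow> (gen ncpoly set \<Rightarrow> gen ncpoly set \<Rightarrow> gen ncpoly set) \<Rightarrow> bool" where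
  "is_weyl_action q \<rho> \<longleftrightarrow>
     (let W = weyl_algebra q; A = coord_algebra q in
       \<rho> \<in> carrier W \<rightarrow>\<^sub>E (carrier A \<rightarrow>\<^sub>E carrier A) \<and>
       (\<forall>w\<in>carrier W. \<forall>f\<in>carrier A. \<forall>g\<in>carrier A. \<rho> w (f \<oplus>\<^bsub>A\<^esub> g) = \<rho> w f \<oplus>\<^bsub>A\<^esub> \<rho> w g) \<and>
       (\<forall>v\<in>carrier W. \<forall>w\<in>carrier W. \<forall>f\<in>carrier A. \<rho> (v \<oplus>\<^bsub>W\<^esub> w) f = \<rho> v f \<oplus>\<^bsub>A\<^esub> \<rho> w f) \<and>
       (\<forall>v\<in>carrier W. \<forall>w\<in>carrier W. \<forall>f\<in>carrier A. \<rho> (v \<otimes>\<^bsub>W\<^esub> w) f = \<rho> v (\<rho> w f)) \<and>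
       (\<forall>c. \<forall>f\<in>carrier A. \<rho> (in_weyl q (const c)) f = in_coord q (const c) \<otimes>\<^bsub>A\<^esub> f) \<and>
       (\<forall>g\<in>coord_gens. \<forall>f\<in>carrier A.
          \<rho> (in_weyl q (letter g)) f = in_coord q (letter g) \<otimes>\<^bsub>A\<^esub> f) \<and>
       (\<forall>g\<in>deriv_gens. \<rho> (in_weyl q (letter g)) \<one>\<^bsub>A\<^esub> = \<zero>\<^bsub>A\<^esub>))"

definition weyl_action ::
    "complex \<Rightarrow> gen ncpoly set \<Rightarrow> gen ncpoly set \<Rightarrow> gen ncpoly set" where
  "weyl_action q = (THE \<rho>. is_weyl_action q \<rho>)"

definition euler :: "complex \<Rightarrow> gen ncpoly set" where
  "euler q =
     in_weyl q (letter Gx * letter Dx + letter Gy * letter Dy + letter Gtheta * letter Dtheta)"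

definition euler_normal :: "complex \<Rightarrow> gen ncpoly set" where
  "euler_normal q =
     \<one>\<^bsub>weyl_algebra q\<^esub> \<oplus>\<^bsub>weyl_algebra q\<^esub>
     in_weyl q (const (q powi (-2) - 1)) \<otimes>\<^bsub>weyl_algebra q\<^esub> euler q"

definition q_bracket :: "complex \<Rightarrow> nat \<Rightarrow> complex" where
  "q_bracket p n = (p ^ n - 1) / (p - 1)"

end

theory Submission
  imports Defs
begin

text \<open>
  Every generator \<open>g\<close> satisfies \<open>E g = c g E\<close> with \<open>c\<close> equal to \<open>q\<^sup>-\<^sup>2\<close> or \<open>q\<^sup>2\<close>; this
  yields normality, and (i) is the relation \<open>E f\<^sub>n = q\<^sup>-\<^sup>2\<^sup>n f\<^sub>n E\<close> divided by \<open>q\<^sup>-\<^sup>2 - 1\<close>.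
  Applying (i) to \<open>1\<close> and to \<open>f\<^sub>k\<close> gives (ii).  The action itself comes from explicit
  operators on the span of the monomials \<open>\<theta>\<^sup>e x\<^sup>a y\<^sup>b\<close>: they satisfy all relations, hence
  the monomials form a basis of the coordinate algebra and the operators transport to it.
  Since \<open>E\<close> fixes \<open>1\<close> in this representation, \<open>E \<noteq> 0\<close>.
\<close>

section \<open>Linear extension\<close>

text \<open>Put p = q^-2. For a coordinate generator g the rule D g = g + p g D is affine in D and
  accumulates extra terms along a word. The map t -> 1 + p t has the fixed point -1/(p - 1), and E
  is D shifted by this point and multiplied by p - 1; hence the rule for E is homogeneous, and
  crossing a coordinate word of length n costs exactly the factor p^n. Membership in the relation
  ideal only proves that elements are equal. That E is different from 0, and that operators on
  classes are well defined, needs a concrete module on which all relations have been checked.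
  Moreover \<open>weyl_action\<close> is a definite description, so (ii) can be reasoned about only
  once the action is known to exist and to be unique. Independence of the monomials is obtained
  without a confluence argument: the coordinates of a polynomial are read off by letting it act on
  the basis vector that represents 1.\<close>

definition scl :: "complex \<Rightarrow> ('a \<Rightarrow>\<^sub>0 complex) \<Rightarrow> 'a \<Rightarrow>\<^sub>0 complex" where
  "scl c = Poly_Mapping.map ((*) c)"

lemma lookup_scl [simp]: "Poly_Mapping.lookup (scl c v) k = c * Poly_Mapping.lookup v k"
  by (simp add: scl_def Poly_Mapping.map.rep_eq when_def)

lemma scl_simps [simp]:
  "scl c 0 = 0" "scl 0 v = 0" "scl 1 v = v" "scl c (scl d v) = scl (c * d) v"
  "scl c (Poly_Mapping.single k d) = Poly_Mapping.single k (c * d)"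
  by (auto intro!: poly_mapping_eqI simp: lookup_single when_def)

lemma scl_add: "scl c (u + v) = scl c u + scl c v"
  and scl_add_left: "scl (c + d) u = scl c u + scl d u"
  by (auto intro!: poly_mapping_eqI simp: lookup_add algebra_simps)

lemma scl_sum: "scl c (sum f A) = (\<Sum>a\<in>A. scl c (f a))"
  by (induction A rule: infinite_finite_induct) (auto simp: scl_add)

definition lin :: "('a \<Rightarrow> 'b \<Rightarrow>\<^sub>0 complex) \<Rightarrow> ('a \<Rightarrow>\<^sub>0 complex) \<Rightarrow> 'b \<Rightarrow>\<^sub>0 complex" where
  "lin f v = (\<Sum>k\<in>Poly_Mapping.keys v. scl (Poly_Mapping.lookup v k) (f k))"

lemma lin_superset:
  assumes "finite A" "Poly_Mapping.keys v \<subseteq> A"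
  shows "lin f v = (\<Sum>k\<in>A. scl (Poly_Mapping.lookup v k) (f k))"
  unfolding lin_def using assms by (intro sum.mono_neutral_left) (auto simp: in_keys_iff)

lemma lin_zero [simp]: "lin f 0 = 0"
  by (simp add: lin_def)

lemma lin_single [simp]: "lin f (Poly_Mapping.single k c) = scl c (f k)"
  by (subst lin_superset[of "{k}"]) auto

lemma lin_add: "lin f (u + v) = lin f u + lin f v"
proof -
  let ?A = "Poly_Mapping.keys u \<union> Poly_Mapping.keys v"
  have "Poly_Mapping.keys (u + v) \<subseteq> ?A" by (rule keys_add)
  then show ?thesis
    by (simp add: lin_superset[of ?A] lookup_add scl_add_left sum.distrib)
qed

lemma lin_scl: "lin f (scl c v) = scl c (lin f v)"
proof -
  have "Poly_Mapping.keys (scl c v) \<subseteq> Poly_Mapping.keys v"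
    by (auto simp: in_keys_iff)
  then show ?thesis
    by (simp add: lin_superset[of "Poly_Mapping.keys v"] scl_sum)
qed

lemma poly_mapping_eq_sum_single:
  "v = (\<Sum>k\<in>Poly_Mapping.keys v. Poly_Mapping.single k (Poly_Mapping.lookup v k))"
  by (rule poly_mapping_eqI) (simp add: lookup_sum lookup_single when_def in_keys_iff if_distrib cong: if_cong)

lemma poly_mapping_induct_sum [case_names single add]:
  fixes v :: "'a \<Rightarrow>\<^sub>0 complex"
  assumes "\<And>k c. P (Poly_Mapping.single k c)" "\<And>u v. P u \<Longrightarrow> P v \<Longrightarrow> P (u + v)"
  shows "P v"
proof -
  have "P 0" using assms(1)[of undefined 0] by simp
  then have "P (\<Sum>k\<in>A. Poly_Mapping.single k (Poly_Mapping.lookup v k))" for A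
    by (induction A rule: infinite_finite_induct) (auto intro: assms)
  then show ?thesis using poly_mapping_eq_sum_single[of v] by metis
qed

section \<open>Words\<close>

definition word :: "'g list \<Rightarrow> 'g ncpoly" where
  "word w = Poly_Mapping.single w 1"

lemma single_times: "Poly_Mapping.single v a * Poly_Mapping.single w b = Poly_Mapping.single (v @ w) (a * b)"
  for a b :: complex
  by (simp add: mult_single plus_list_def)

lemma word_Nil: "word [] = 1"
  by (simp add: word_def flip: zero_list_def)

lemma word_Cons: "word (g # w) = letter g * word w"
  by (simp add: word_def letter_def single_times)

lemma const_times: "const c * p = scl c p"
  by (induction p rule: poly_mapping_induct_sum)
     (auto simp: const_def single_times distrib_left scl_add)

lemma times_const: "p * const c = const c * p"
  by (induction p rule: poly_mapping_induct_sum)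
     (auto simp: const_def single_times distrib_left distrib_right mult.commute)

lemma const_simps: "const 1 = 1" "const 0 = 0" "const a * const b = const (a * b)"
  "const (a + b) = const a + const b" "const (- a) = - const a" "const (a - b) = const a - const b"
  by (auto simp: const_def single_times single_add single_diff single_uminus zero_list_def simp flip: single_one)

lemma single_eq_const_word: "Poly_Mapping.single w c = const c * word w"
  by (simp add: const_def word_def single_times)

section \<open>Representations of the free algebra\<close>

text \<open>\<open>foldr\<close> lets the last letter act first, so concatenation of words becomes
  composition. Thus \<open>rep\<close> makes the formal span of the index type a left module over
  the free algebra, for any choice of the operators \<open>\<omega> g\<close>.\<close>

definition opw :: "('g \<Rightarrow> 'i \<Rightarrow> 'i \<Rightarrow>\<^sub>0 complex) \<Rightarrow> 'g list \<Rightarrow> ('i \<Rightarrow>\<^sub>0 complex) \<Rightarrow> 'i \<Rightarrow>\<^sub>0 complex" where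
  "opw \<omega> w = foldr (\<lambda>g. lin (\<omega> g)) w"

definition rep :: "('g \<Rightarrow> 'i \<Rightarrow> 'i \<Rightarrow>\<^sub>0 complex) \<Rightarrow> 'g ncpoly \<Rightarrow> ('i \<Rightarrow>\<^sub>0 complex) \<Rightarrow> 'i \<Rightarrow>\<^sub>0 complex" where
  "rep \<omega> p v = lin (\<lambda>w. opw \<omega> w v) p"

lemma opw_simps [simp]: "opw \<omega> [] v = v" "opw \<omega> (g # w) v = lin (\<omega> g) (opw \<omega> w v)"
  "opw \<omega> (w @ w') v = opw \<omega> w (opw \<omega> w' v)"
  by (auto simp: opw_def)

lemma opw_add: "opw \<omega> w (u + v) = opw \<omega> w u + opw \<omega> w v"
  by (induction w) (auto simp: lin_add)

lemma opw_scl: "opw \<omega> w (scl c v) = scl c (opw \<omega> w v)"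
  by (induction w) (auto simp: lin_scl)

lemma rep_add: "rep \<omega> (p + r) v = rep \<omega> p v + rep \<omega> r v"
  by (simp add: rep_def lin_add)

lemma rep_zero [simp]: "rep \<omega> 0 v = 0"
  by (simp add: rep_def)

lemma rep_uminus: "rep \<omega> (- p) v = - rep \<omega> p v"
  using rep_add[of \<omega> p "- p" v] by (simp add: eq_neg_iff_add_eq_0 add.commute)

lemma rep_diff: "rep \<omega> (p - r) v = rep \<omega> p v - rep \<omega> r v"
  using rep_add[of \<omega> p "- r" v] by (simp add: rep_uminus)

lemma rep_single: "rep \<omega> (Poly_Mapping.single w c) v = scl c (opw \<omega> w v)"
  by (simp add: rep_def)

lemma rep_const: "rep \<omega> (const c) v = scl c v"
  by (simp add: const_def rep_single)

lemma rep_one: "rep \<omega> 1 v = v"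
  using rep_const[of \<omega> 1 v] by (simp add: const_simps)

lemma rep_letter: "rep \<omega> (letter g) v = lin (\<omega> g) v"
  by (simp add: letter_def rep_single)

lemma rep_add_right: "rep \<omega> p (u + v) = rep \<omega> p u + rep \<omega> p v"
  by (induction p rule: poly_mapping_induct_sum) (auto simp: rep_single opw_add rep_add scl_add)

lemma rep_scl_right: "rep \<omega> p (scl c v) = scl c (rep \<omega> p v)"
  by (induction p rule: poly_mapping_induct_sum)
     (auto simp: rep_single opw_scl rep_add scl_add mult.commute)

lemma rep_zero_right [simp]: "rep \<omega> p 0 = 0"
  using rep_scl_right[of \<omega> p 0 0] by simp

lemma rep_times: "rep \<omega> (p * r) v = rep \<omega> p (rep \<omega> r v)"
proof (induction p rule: poly_mapping_induct_sum)
  case (single w c)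
  show ?case
    by (induction r rule: poly_mapping_induct_sum)
       (auto simp: rep_single single_times opw_scl distrib_left rep_add rep_add_right)
qed (auto simp: distrib_right rep_add)

lemma rep_eq_zero_on_basis:
  assumes "\<And>i. rep \<omega> p (Poly_Mapping.single i 1) = 0"
  shows "rep \<omega> p v = 0"
proof (induction v rule: poly_mapping_induct_sum)
  case (single k c)
  have "Poly_Mapping.single k c = scl c (Poly_Mapping.single k 1)" by simp
  then show ?case using assms[of k] by (metis rep_scl_right scl_simps(1))
qed (auto simp: rep_add_right)

section \<open>The action on the basis\<close>

text \<open>The triple \<open>(e, a, b)\<close> stands for the monomial \<open>\<theta>\<^sup>e x\<^sup>a y\<^sup>b\<close>.\<close>

type_synonym idx = "bool \<times> nat \<times> nat"

text \<open>The values are forced by moving a letter into \<theta>^e x^a y^b. Crossing \<theta>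
  costs q for x and y, and q^-1 for their derivatives; \<open>Dy\<close> crosses x^a at the cost
  q^(-2a); repeated use of the relation of a derivative with its own coordinate gives the bracket.
  For \<open>Dtheta\<close> the scalar is 1 + (p - 1)([a] + p^a [b]) = 1 + (p - 1)[a + b] = p^(a +
  b) with p = q^-2. The truncated \<open>a - 1\<close> and \<open>b - 1\<close> are harmless at 0,
  where the bracket vanishes.\<close>

fun basis_op :: "complex \<Rightarrow> gen \<Rightarrow> idx \<Rightarrow> (idx \<Rightarrow>\<^sub>0 complex)" where
  "basis_op q Gx (e, a, b) = Poly_Mapping.single (e, Suc a, b) (if e then q else 1)"
| "basis_op q Gy (e, a, b) = Poly_Mapping.single (e, a, Suc b) (if e then q else 1)"
| "basis_op q Gtheta (e, a, b) = (if e then 0 else Poly_Mapping.single (True, a, b) 1)"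
| "basis_op q Dx (e, a, b) = Poly_Mapping.single (e, a - 1, b)
     ((if e then inverse q else 1) * q_bracket (inverse (q\<^sup>2)) a)"
| "basis_op q Dy (e, a, b) = Poly_Mapping.single (e, a, b - 1)
     ((if e then inverse q else 1) * inverse (q\<^sup>2) ^ a * q_bracket (inverse (q\<^sup>2)) b)"
| "basis_op q Dtheta (e, a, b) =
     (if e then Poly_Mapping.single (False, a, b) (inverse (q\<^sup>2) ^ (a + b)) else 0)"

lemma q_bracket_0 [simp]: "q_bracket p 0 = 0"
  by (simp add: q_bracket_def)

lemma q_bracket_Suc: "p \<noteq> 1 \<Longrightarrow> q_bracket p (Suc n) = 1 + p * q_bracket p n"
  by (simp add: q_bracket_def field_simps)

lemma q_powi: "q powi (-1) = inverse q" "q powi (-2) = inverse (q\<^sup>2)"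
  "q powi (- 2 * int n) = inverse (q\<^sup>2) ^ n" for q :: complex
  by (simp_all add: power_int_minus power_int_mult power_inverse)

text \<open>All terms of one relation shift the exponents equally, so on a monomial each relation
  amounts to a single scalar identity. Splitting \<open>a\<close> and \<open>b\<close> into zero and
  successor keeps this true in spite of the truncated predecessors.\<close>

lemma rep_weyl_rels:
  assumes "q \<noteq> 0" "q\<^sup>2 \<noteq> 1" "r \<in> weyl_rels q"
  shows "rep (basis_op q) r v = 0"
proof (rule rep_eq_zero_on_basis)
  fix i :: idx
  obtain e a b where i: "i = (e, a, b)" by (cases i)
  define p where "p = inverse (q\<^sup>2)"
  have p: "p \<noteq> 1" "inverse q = q * p" "p * q * q = 1" "q * q * p = 1" "q * (q * p) = 1"
    using assms by (auto simp: p_def power2_eq_square field_simps)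
  \<comment> \<open>Powers of \<open>p\<close> are traded for brackets. With
    \<open>inverse q = q * p\<close> there remain polynomial identities in \<open>p\<close>,
    \<open>q\<close> and brackets, modulo \<open>p * q * q = 1\<close>.\<close>
  have pow: "p ^ n = 1 + (p - 1) * q_bracket p n" for n
    using p by (simp add: q_bracket_def)
  have cancel: "p * (q * q) = 1" "p * (q * (q * z)) = z" for z
    using p(3) by (simp_all flip: mult.assoc)
  have single_zeroI: "Poly_Mapping.single k c = 0" if "c = 0" for k :: idx and c :: complex
    using that by simp
  show "rep (basis_op q) r (Poly_Mapping.single i 1) = 0"
    using assms(3) unfolding weyl_rels_def coord_rels_def cross_rels_def deriv_rels_def Let_def q_powi i
    by (cases e; cases a; cases b)
       (auto simp: rep_diff rep_add rep_times rep_const rep_letter rep_one lin_scl lin_add scl_add p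
          power_add simp flip: p_def single_diff single_add intro!: single_zeroI,
        simp_all only: q_bracket_Suc[OF p(1)] pow q_bracket_0,
        simp_all add: algebra_simps cancel)
qed

section \<open>Presented algebras\<close>

lemma free_algebra_simps [simp]:
  "x \<otimes>\<^bsub>free_algebra S\<^esub> y = x * y" "x \<oplus>\<^bsub>free_algebra S\<^esub> y = x + y"
  "\<one>\<^bsub>free_algebra S\<^esub> = 1" "\<zero>\<^bsub>free_algebra S\<^esub> = 0"
  by (simp_all add: free_algebra_def)

lemma carrier_free_UNIV [simp]: "carrier (free_algebra UNIV) = UNIV"
  by (simp add: free_algebra_def)

lemma free_closed:
  "1 \<in> carrier (free_algebra S)" "0 \<in> carrier (free_algebra S)"
  "const c \<in> carrier (free_algebra S)"
  "g \<in> S \<Longrightarrow> letter g \<in> carrier (free_algebra S)"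
  "p \<in> carrier (free_algebra S) \<Longrightarrow> r \<in> carrier (free_algebra S) \<Longrightarrow> p + r \<in> carrier (free_algebra S)"
  "p \<in> carrier (free_algebra S) \<Longrightarrow> r \<in> carrier (free_algebra S) \<Longrightarrow> p - r \<in> carrier (free_algebra S)"
  "p \<in> carrier (free_algebra S) \<Longrightarrow> r \<in> carrier (free_algebra S) \<Longrightarrow> p * r \<in> carrier (free_algebra S)"
  "p \<in> carrier (free_algebra S) \<Longrightarrow> p ^ n \<in> carrier (free_algebra S)"
proof -
  interpret ring "free_algebra S" by (rule ring_free_algebra)
  show *: "1 \<in> carrier (free_algebra S)" "0 \<in> carrier (free_algebra S)"
    using one_closed zero_closed by auto
  show "const c \<in> carrier (free_algebra S)" "g \<in> S \<Longrightarrow> letter g \<in> carrier (free_algebra S)"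
    by (auto simp: free_algebra_def const_def letter_def)
  show "p + r \<in> carrier (free_algebra S)" "p * r \<in> carrier (free_algebra S)"
    if "p \<in> carrier (free_algebra S)" "r \<in> carrier (free_algebra S)" for p r
    using that a_closed[of p r] m_closed[of p r] by auto
  then show "p ^ n \<in> carrier (free_algebra S)" if "p \<in> carrier (free_algebra S)"
    using that * by (induction n) auto
  show "p - r \<in> carrier (free_algebra S)"
    if "p \<in> carrier (free_algebra S)" "r \<in> carrier (free_algebra S)"
    using that keys_diff[of p r] by (auto simp: free_algebra_def)
qed

text \<open>Words are built by prepending letters, which suits left actions: the inductive step
  knows the effect of \<open>p\<close> and applies one more operator after it.\<close>

lemma free_algebra_induct [consumes 1, case_names add const letter]:
  assumes "p \<in> carrier (free_algebra S)"
    and add: "\<And>p r. p \<in> carrier (free_algebra S) \<Longrightarrow> r \<in> carrier (free_algebra S) \<Longrightarrow> P p \<Longrightarrow> P r \<Longrightarrow> P (p + r)"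
    and const: "\<And>c. P (const c)"
    and letter: "\<And>g p. g \<in> S \<Longrightarrow> p \<in> carrier (free_algebra S) \<Longrightarrow> P p \<Longrightarrow> P (letter g * p)"
  shows "P p"
proof -
  have single_closed: "Poly_Mapping.single w c \<in> carrier (free_algebra S)" if "w \<in> lists S" for w c
    using that by (simp add: free_algebra_def)
  have single: "P (Poly_Mapping.single w c)" if "w \<in> lists S" for w c
    using that
  proof (induction w)
    case Nil
    then show ?case using const[of c] by (simp add: const_def)
  next
    case (Cons g w)
    have "Poly_Mapping.single (g # w) c = letter g * Poly_Mapping.single w c"
      by (simp add: letter_def single_times)
    then show ?case using Cons letter single_closed by auto
  qed
  have "(\<Sum>k\<in>A. Poly_Mapping.single k (Poly_Mapping.lookup p k)) \<in> carrier (free_algebra S) \<and>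
        P (\<Sum>k\<in>A. Poly_Mapping.single k (Poly_Mapping.lookup p k))" if "A \<subseteq> lists S" for A
    using that
    by (induction A rule: infinite_finite_induct)
       (use const[of 0] in \<open>auto simp: const_simps free_closed intro!: add single single_closed free_closed(5)\<close>)
  moreover have "Poly_Mapping.keys p \<subseteq> lists S"
    using assms(1) by (simp add: free_algebra_def)
  ultimately show ?thesis
    using poly_mapping_eq_sum_single[of p] by metis
qed

locale presentation =
  fixes S :: "'g set" and Rel :: "'g ncpoly set"
  assumes rels: "Rel \<subseteq> carrier (free_algebra S)"
begin

abbreviation "F \<equiv> free_algebra S"
abbreviation "I \<equiv> relation_ideal S Rel"
abbreviation "Q \<equiv> presented_algebra S Rel"
abbreviation "\<pi> \<equiv> residue_class S Rel"

sublocale F: ring F by (rule ring_free_algebra)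

lemma ideal_I: "ideal I F"
  unfolding relation_ideal_def by (rule F.genideal_ideal[OF rels])

sublocale Q: ring Q
  unfolding presented_algebra_def by (rule ideal.quotient_is_ring[OF ideal_I])

lemma rel_in_ideal: "r \<in> Rel \<Longrightarrow> r \<in> I"
  unfolding relation_ideal_def using F.genideal_self[OF rels] by blast

lemma ideal_least: "ideal J F \<Longrightarrow> Rel \<subseteq> J \<Longrightarrow> I \<subseteq> J"
  unfolding relation_ideal_def by (rule F.genideal_minimal)

lemma
  shows I_zero: "0 \<in> I"
    and I_add: "a \<in> I \<Longrightarrow> b \<in> I \<Longrightarrow> a + b \<in> I"
    and I_lmult: "a \<in> I \<Longrightarrow> c \<in> carrier F \<Longrightarrow> c * a \<in> I"
    and I_rmult: "a \<in> I \<Longrightarrow> c \<in> carrier F \<Longrightarrow> a * c \<in> I"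
    and I_uminus: "a \<in> I \<Longrightarrow> - a \<in> I"
    and I_diff: "a \<in> I \<Longrightarrow> b \<in> I \<Longrightarrow> a - b \<in> I"
proof -
  show *: "0 \<in> I" "a \<in> I \<Longrightarrow> b \<in> I \<Longrightarrow> a + b \<in> I" "a \<in> I \<Longrightarrow> c \<in> carrier F \<Longrightarrow> c * a \<in> I"
    "a \<in> I \<Longrightarrow> c \<in> carrier F \<Longrightarrow> a * c \<in> I" for a b c
    using additive_subgroup.zero_closed[OF ideal.axioms(1)[OF ideal_I]]
      additive_subgroup.a_closed[OF ideal.axioms(1)[OF ideal_I], of a b]
      ideal.I_l_closed[OF ideal_I, of a c] ideal.I_r_closed[OF ideal_I, of a c] by auto
  show **: "- a \<in> I" if "a \<in> I" for a
    using *(3)[OF that free_closed(3)[of "- 1"]] by (simp add: const_simps)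
  show "a \<in> I \<Longrightarrow> b \<in> I \<Longrightarrow> a - b \<in> I"
    using *(2)[of a "- b"] **[of b] by simp
qed

text \<open>The bridge from the quotient to explicit computation: identities between classes are
  reduced to membership of a difference of polynomials in \<open>I\<close>.\<close>

lemma pi_eq_iff:
  assumes "a \<in> carrier F" "b \<in> carrier F"
  shows "\<pi> a = \<pi> b \<longleftrightarrow> a - b \<in> I"
proof -
  have "- b \<in> carrier F"
    using free_closed(6)[OF free_closed(2) assms(2)] by simp
  then have "\<ominus>\<^bsub>F\<^esub> b = - b"
    using assms(2) by (intro F.minus_equality) auto
  then have "a \<ominus>\<^bsub>F\<^esub> b = a - b"
    by (simp add: a_minus_def)
  then show ?thesis
    using F.quotient_eq_iff_same_a_r_cos[OF ideal_I assms] by (simp add: residue_class_def)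
qed

lemma pi_hom: "\<pi> \<in> ring_hom F Q"
  using ideal.rcos_ring_hom[OF ideal_I] unfolding residue_class_def[abs_def] presented_algebra_def .

lemma pi_closed: "a \<in> carrier F \<Longrightarrow> \<pi> a \<in> carrier Q"
  using pi_hom by (rule ring_hom_closed)

lemma pi_add: "a \<in> carrier F \<Longrightarrow> b \<in> carrier F \<Longrightarrow> \<pi> a \<oplus>\<^bsub>Q\<^esub> \<pi> b = \<pi> (a + b)"
  using ring_hom_add[OF pi_hom] by simp

lemma pi_mult: "a \<in> carrier F \<Longrightarrow> b \<in> carrier F \<Longrightarrow> \<pi> a \<otimes>\<^bsub>Q\<^esub> \<pi> b = \<pi> (a * b)"
  using ring_hom_mult[OF pi_hom] by simp

lemma pi_one: "\<one>\<^bsub>Q\<^esub> = \<pi> 1"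
  using ring_hom_one[OF pi_hom] by simp

lemma pi_zero: "\<zero>\<^bsub>Q\<^esub> = \<pi> 0"
  by (metis F.zero_closed Q.add.r_cancel_one' add_0 free_algebra_simps(4) pi_add pi_closed)

lemma pi_surj: "f \<in> carrier Q \<Longrightarrow> \<exists>a\<in>carrier F. f = \<pi> a"
  unfolding presented_algebra_def residue_class_def FactRing_def
  by (auto simp: A_RCOSETS_def')

lemma mem_pi_iff:
  assumes "a \<in> carrier F"
  shows "b \<in> \<pi> a \<longleftrightarrow> b \<in> carrier F \<and> b - a \<in> I"
proof
  assume "b \<in> \<pi> a"
  then obtain h where "h \<in> I" "b = h + a"
    unfolding residue_class_def a_r_coset_def' by auto
  then show "b \<in> carrier F \<and> b - a \<in> I"
    using assms ideal.Icarr[OF ideal_I, of h] free_closed(5)[of h S a] by auto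
next
  assume "b \<in> carrier F \<and> b - a \<in> I"
  then show "b \<in> \<pi> a"
    unfolding residue_class_def a_r_coset_def' by (auto intro!: bexI[of _ "b - a"])
qed

end

text \<open>The part of the larger ideal inside \<open>free_algebra S\<close> is an ideal there and
  contains \<open>Rel\<close>, so minimality of the generated ideal applies. This is what makes the
  maps from the coordinate and derivative algebras to the Weyl algebra well defined.\<close>

lemma relation_ideal_mono:
  assumes "S \<subseteq> T" "Rel \<subseteq> Rel'" "Rel \<subseteq> carrier (free_algebra S)" "Rel' \<subseteq> carrier (free_algebra T)"
  shows "relation_ideal S Rel \<subseteq> relation_ideal T Rel'"
proof -
  interpret A: presentation S Rel by standard fact
  interpret B: presentation T Rel' by standard fact
  have sub: "carrier (free_algebra S) \<subseteq> carrier (free_algebra T)"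
    using assms(1) by (auto simp: free_algebra_def)
  have "ideal (relation_ideal T Rel' \<inter> carrier (free_algebra S)) (free_algebra S)"
  proof (rule idealI)
    show "subgroup (relation_ideal T Rel' \<inter> carrier (free_algebra S)) (add_monoid (free_algebra S))"
    proof (rule A.F.add.subgroupI, goal_cases)
      case (3 a)
      then have "- a \<in> carrier (free_algebra S)"
        using free_closed(6)[OF free_closed(2), of a S] by simp
      moreover from this have "\<ominus>\<^bsub>free_algebra S\<^esub> a = - a"
        using 3 by (intro A.F.minus_equality) auto
      ultimately show ?case using 3 B.I_uminus by (auto simp: a_inv_def)
    next
      case (4 a b)
      then show ?case using B.I_add[of a b] free_closed(5)[of a S b] by auto
    qed (use B.I_zero free_closed(2) in auto)
  qed (use sub B.I_lmult B.I_rmult free_closed(7) in \<open>auto simp: ring_free_algebra\<close>)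
  moreover have "Rel \<subseteq> relation_ideal T Rel' \<inter> carrier (free_algebra S)"
    using assms B.rel_in_ideal by auto
  ultimately show ?thesis using A.ideal_least by blast
qed

section \<open>The Euler derivation\<close>

interpretation W: presentation UNIV "weyl_rels q" for q
  by standard simp

interpretation A: presentation coord_gens "coord_rels q" for q
  by standard (auto simp: coord_rels_def Let_def intro!: free_closed)

interpretation DA: presentation deriv_gens "deriv_rels q" for q
  by standard (auto simp: deriv_rels_def Let_def intro!: free_closed)

definition euler_poly :: "gen ncpoly" where
  "euler_poly = letter Gx * letter Dx + letter Gy * letter Dy + letter Gtheta * letter Dtheta"

definition euler_normal_poly :: "complex \<Rightarrow> gen ncpoly" where
  "euler_normal_poly p = 1 + const (p - 1) * euler_poly"

text \<open>Used from left to right, these rules collect scalars at the front of each monomial, so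
  that together with \<open>algebra_simps\<close> explicit certificates of ideal membership can be
  compared term by term.\<close>

lemma const_mult_letter:
  "letter g * const c = const c * letter g" "letter g * (const c * r) = const c * (letter g * r)"
  "const a * (const b * r) = const (a * b) * r"
  by (rule times_const) (metis mult.assoc times_const, metis const_simps(3) mult.assoc)

section \<open>Commutation of D and E with the single generators\<close>

context
  fixes q p r :: complex
  assumes q0: "q \<noteq> 0" and p_def: "p = inverse (q\<^sup>2)" and r_def: "r = inverse q"
begin

lemma params: "r * r = p" "p * q = r" "r * q = 1" "q * r = 1" "q * p = r"
  using q0 by (auto simp: p_def r_def power2_eq_square)

lemma weyl_rel_in_ideal:
  "letter Gx * letter Gy - letter Gy * letter Gx \<in> W.I q"
  "letter Gx * letter Gtheta - const q * letter Gtheta * letter Gx \<in> W.I q"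
  "letter Gy * letter Gtheta - const q * letter Gtheta * letter Gy \<in> W.I q"
  "letter Gtheta * letter Gtheta \<in> W.I q"
  "letter Dx * letter Gx - (1 + const p * letter Gx * letter Dx) \<in> W.I q"
  "letter Dy * letter Gx - const p * letter Gx * letter Dy \<in> W.I q"
  "letter Dtheta * letter Gx - const r * letter Gx * letter Dtheta \<in> W.I q"
  "letter Dy * letter Gy - (1 + const p * letter Gy * letter Dy + const (p - 1) * letter Gx * letter Dx) \<in> W.I q"
  "letter Dx * letter Gy - letter Gy * letter Dx \<in> W.I q"
  "letter Dtheta * letter Gy - const r * letter Gy * letter Dtheta \<in> W.I q"
  "letter Dtheta * letter Gtheta - (1 - letter Gtheta * letter Dtheta + const (p - 1) * (letter Gx * letter Dx + letter Gy * letter Dy)) \<in> W.I q"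
  "letter Dx * letter Gtheta - const r * letter Gtheta * letter Dx \<in> W.I q"
  "letter Dy * letter Gtheta - const r * letter Gtheta * letter Dy \<in> W.I q"
  "letter Dx * letter Dy - const p * letter Dy * letter Dx \<in> W.I q"
  "letter Dx * letter Dtheta - const r * letter Dtheta * letter Dx \<in> W.I q"
  "letter Dy * letter Dtheta - const r * letter Dtheta * letter Dy \<in> W.I q"
  "letter Dtheta * letter Dtheta \<in> W.I q"
  by (rule W.rel_in_ideal, simp only: weyl_rels_def coord_rels_def cross_rels_def deriv_rels_def
        Let_def q_powi p_def r_def insert_iff Un_iff refl simp_thms)+

lemmas W_closed = W.I_add[of _ q] W.I_diff[of _ q] W.I_lmult[of _ q] W.I_rmult[of _ q]
  weyl_rel_in_ideal carrier_free_UNIV UNIV_I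

text \<open>Each case is a certificate: the difference is written as a combination of defining
  relations, found by moving derivatives to the right. The common factor \<open>p\<close> is read
  off a cross relation, with \<open>p * q = r\<close> when \<open>Gtheta\<close> has to be crossed,
  or it arises as \<open>1 + (p - 1)\<close>, where \<open>p - 1\<close> stems from the correction
  terms in the relations of \<open>Dy\<close> with \<open>Gy\<close> and of \<open>Dtheta\<close>
  with \<open>Gtheta\<close>.\<close>

lemma euler_coord:
  assumes "g \<in> coord_gens"
  shows "euler_poly * letter g - letter g - const p * letter g * euler_poly \<in> W.I q"
proof -
  let ?x = "letter Gx" and ?y = "letter Gy" and ?t = "letter Gtheta"
    and ?dx = "letter Dx" and ?dy = "letter Dy" and ?dt = "letter Dtheta"
  consider "g = Gx" | "g = Gy" | "g = Gtheta" using assms by auto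
  then show ?thesis
  proof cases
    case 1
    have "euler_poly * ?x - ?x - const p * ?x * euler_poly =
        ?x * (?dx * ?x - (1 + const p * ?x * ?dx)) + ?y * (?dy * ?x - const p * ?x * ?dy)
      + ?t * (?dt * ?x - const r * ?x * ?dt) - const p * (?x * ?y - ?y * ?x) * ?dy
      - const p * (?x * ?t - const q * ?t * ?x) * ?dt"
      by (simp add: euler_poly_def algebra_simps const_simps const_mult_letter params)
    also have "\<dots> \<in> W.I q"
      by (simp only: W_closed)
    finally show ?thesis using 1 by simp
  next
    case 2
    have "euler_poly * ?y - ?y - const p * ?y * euler_poly =
        ?x * (?dx * ?y - ?y * ?dx)
      + ?y * (?dy * ?y - (1 + const p * ?y * ?dy + const (p - 1) * ?x * ?dx))
      + ?t * (?dt * ?y - const r * ?y * ?dt) + (?x * ?y - ?y * ?x) * ?dx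
      - const p * (?y * ?t - const q * ?t * ?y) * ?dt"
      by (simp add: euler_poly_def algebra_simps const_simps const_mult_letter params)
    also have "\<dots> \<in> W.I q"
      by (simp only: W_closed)
    finally show ?thesis using 2 by simp
  next
    case 3
    \<comment> \<open>The factor \<open>1 + p\<close> cancels \<open>?t * ?t * ?dt\<close>, which
      enters once through the relation of \<open>Dtheta\<close> with \<open>Gtheta\<close> and
      \<open>p\<close> times through \<open>const p * ?t * euler_poly\<close>.\<close>
    have "euler_poly * ?t - ?t - const p * ?t * euler_poly =
        ?x * (?dx * ?t - const r * ?t * ?dx) + ?y * (?dy * ?t - const r * ?t * ?dy)
      + ?t * (?dt * ?t - (1 - ?t * ?dt + const (p - 1) * (?x * ?dx + ?y * ?dy)))
      + const r * (?x * ?t - const q * ?t * ?x) * ?dx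
      + const r * (?y * ?t - const q * ?t * ?y) * ?dy - const (1 + p) * (?t * ?t) * ?dt"
      by (simp add: euler_poly_def algebra_simps const_simps const_mult_letter params)
    also have "\<dots> \<in> W.I q"
      by (simp only: W_closed)
    finally show ?thesis using 3 by simp
  qed
qed

text \<open>The mirror image of \<open>euler_coord\<close>: derivatives enter from the left and the
  relations among derivatives do the reordering. The factor \<open>p\<close> now also arises as
  \<open>r * r\<close>, when a derivative other than \<open>Dtheta\<close> crosses both
  \<open>Gtheta\<close> and \<open>Dtheta\<close>.\<close>

lemma euler_deriv:
  assumes "g \<in> deriv_gens"
  shows "letter g * euler_poly - letter g - const p * euler_poly * letter g \<in> W.I q"
proof -
  let ?x = "letter Gx" and ?y = "letter Gy" and ?t = "letter Gtheta"
    and ?dx = "letter Dx" and ?dy = "letter Dy" and ?dt = "letter Dtheta"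
  consider "g = Dx" | "g = Dy" | "g = Dtheta" using assms by auto
  then show ?thesis
  proof cases
    case 1
    have "?dx * euler_poly - ?dx - const p * euler_poly * ?dx =
        (?dx * ?x - (1 + const p * ?x * ?dx)) * ?dx + (?dx * ?y - ?y * ?dx) * ?dy
      + (?dx * ?t - const r * ?t * ?dx) * ?dt + ?y * (?dx * ?dy - const p * ?dy * ?dx)
      + const r * ?t * (?dx * ?dt - const r * ?dt * ?dx)"
      by (simp add: euler_poly_def algebra_simps const_simps const_mult_letter params)
    also have "\<dots> \<in> W.I q"
      by (simp only: W_closed)
    finally show ?thesis using 1 by simp
  next
    case 2
    have "?dy * euler_poly - ?dy - const p * euler_poly * ?dy =
        (?dy * ?x - const p * ?x * ?dy) * ?dx
      + (?dy * ?y - (1 + const p * ?y * ?dy + const (p - 1) * ?x * ?dx)) * ?dy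
      + (?dy * ?t - const r * ?t * ?dy) * ?dt - ?x * (?dx * ?dy - const p * ?dy * ?dx)
      + const r * ?t * (?dy * ?dt - const r * ?dt * ?dy)"
      by (simp add: euler_poly_def algebra_simps const_simps const_mult_letter params)
    also have "\<dots> \<in> W.I q"
      by (simp only: W_closed)
    finally show ?thesis using 2 by simp
  next
    case 3
    have "?dt * euler_poly - ?dt - const p * euler_poly * ?dt =
        (?dt * ?x - const r * ?x * ?dt) * ?dx + (?dt * ?y - const r * ?y * ?dt) * ?dy
      + (?dt * ?t - (1 - ?t * ?dt + const (p - 1) * (?x * ?dx + ?y * ?dy))) * ?dt
      - ?x * (?dx * ?dt - const r * ?dt * ?dx) - ?y * (?dy * ?dt - const r * ?dt * ?dy)
      - const (1 + p) * ?t * (?dt * ?dt)"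
      by (simp add: euler_poly_def algebra_simps const_simps const_mult_letter params)
    also have "\<dots> \<in> W.I q"
      by (simp only: W_closed)
    finally show ?thesis using 3 by simp
  qed
qed

lemma euler_normal_coord:
  assumes "g \<in> coord_gens"
  shows "euler_normal_poly p * letter g - const p * letter g * euler_normal_poly p \<in> W.I q"
proof -
  have "euler_normal_poly p * letter g - const p * letter g * euler_normal_poly p =
      const (p - 1) * (euler_poly * letter g - letter g - const p * letter g * euler_poly)"
    by (simp add: euler_normal_poly_def algebra_simps const_simps const_mult_letter)
  then show ?thesis by (simp only: W.I_lmult[OF euler_coord[OF assms]] carrier_free_UNIV UNIV_I)
qed

lemma euler_normal_deriv:
  assumes "g \<in> deriv_gens"
  shows "letter g * euler_normal_poly p - const p * euler_normal_poly p * letter g \<in> W.I q"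
proof -
  have "letter g * euler_normal_poly p - const p * euler_normal_poly p * letter g =
      const (p - 1) * (letter g * euler_poly - letter g - const p * euler_poly * letter g)"
    by (simp add: euler_normal_poly_def algebra_simps const_simps const_mult_letter)
  then show ?thesis by (simp only: W.I_lmult[OF euler_deriv[OF assms]] carrier_free_UNIV UNIV_I)
qed

end

text \<open>The premise for \<open>0\<close> is separate because there may be no word of length
  \<open>n\<close> over \<open>S\<close> from which to obtain it with coefficient 0.\<close>

lemma homogeneous_induct [consumes 2, case_names word add]:
  assumes "s \<in> carrier (free_algebra S)" "\<forall>w\<in>Poly_Mapping.keys s. length w = n"
    and word: "\<And>w c. w \<in> lists S \<Longrightarrow> length w = n \<Longrightarrow> P (const c * word w)"
    and add: "\<And>s t. P s \<Longrightarrow> P t \<Longrightarrow> P (s + t)" and zero: "P 0"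
  shows "P s"
proof -
  have "P (\<Sum>k\<in>A. Poly_Mapping.single k (Poly_Mapping.lookup s k))"
    if "A \<subseteq> Poly_Mapping.keys s" for A
    using that
  proof (induction A rule: infinite_finite_induct)
    case (insert k A)
    then have "k \<in> lists S" "length k = n"
      using assms(1,2) by (auto simp: free_algebra_def)
    then show ?case
      using insert word add by (simp add: single_eq_const_word)
  qed (simp_all add: zero)
  then show ?thesis by (metis order_refl poly_mapping_eq_sum_single)
qed

section \<open>Extension to words, to homogeneous elements and to the whole Weyl algebra\<close>

context
  fixes q p :: complex
  assumes q0: "q \<noteq> 0" and p_def: "p = inverse (q\<^sup>2)"
begin

lemma euler_normal_coord_word:
  assumes "w \<in> lists coord_gens"
  shows "euler_normal_poly p * word w - const (p ^ length w) * word w * euler_normal_poly p \<in> W.I q"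
  using assms
proof (induction w)
  case Nil
  show ?case by (simp add: word_Nil const_simps W.I_zero)
next
  case (Cons g w)
  have "euler_normal_poly p * word (g # w)
        - const (p ^ length (g # w)) * word (g # w) * euler_normal_poly p =
      (euler_normal_poly p * letter g - const p * letter g * euler_normal_poly p) * word w
      + const p * letter g
        * (euler_normal_poly p * word w - const (p ^ length w) * word w * euler_normal_poly p)"
    by (simp add: word_Cons algebra_simps const_mult_letter)
  also have "\<dots> \<in> W.I q"
    using Cons euler_normal_coord[OF q0 p_def refl, of g]
    by (intro W.I_add W.I_lmult W.I_rmult) auto
  finally show ?case .
qed

lemma euler_normal_deriv_word:
  assumes "w \<in> lists deriv_gens"
  shows "word w * euler_normal_poly p - const (p ^ length w) * euler_normal_poly p * word w \<in> W.I q"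
  using assms
proof (induction w)
  case Nil
  show ?case by (simp add: word_Nil const_simps W.I_zero)
next
  case (Cons g w)
  have "word (g # w) * euler_normal_poly p
        - const (p ^ length (g # w)) * euler_normal_poly p * word (g # w) =
      letter g * (word w * euler_normal_poly p - const (p ^ length w) * euler_normal_poly p * word w)
      + const (p ^ length w)
        * (letter g * euler_normal_poly p - const p * euler_normal_poly p * letter g) * word w"
    by (simp add: word_Cons algebra_simps const_mult_letter)
  also have "\<dots> \<in> W.I q"
    using Cons euler_normal_deriv[OF q0 p_def refl, of g]
    by (intro W.I_add W.I_lmult W.I_rmult) auto
  finally show ?case .
qed

lemma euler_normal_homogeneous:
  assumes "s \<in> carrier (free_algebra coord_gens)" "\<forall>w\<in>Poly_Mapping.keys s. length w = n"
  shows "euler_normal_poly p * s - const (p ^ n) * s * euler_normal_poly p \<in> W.I q"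
  using assms
proof (induction s rule: homogeneous_induct)
  case (word w c)
  have "euler_normal_poly p * (const c * word w) - const (p ^ n) * (const c * word w) * euler_normal_poly p
      = const c * (euler_normal_poly p * word w - const (p ^ n) * word w * euler_normal_poly p)"
    by (simp only: right_diff_distrib times_const[of "euler_normal_poly p" c] const_simps(3)
        mult.commute[of c "p ^ n"] flip: mult.assoc)
  then show ?case
    using W.I_lmult[OF euler_normal_coord_word[OF word(1)], of "const c"] word(2) by simp
next
  case (add s t)
  then show ?case using W.I_add[OF add] by (simp add: algebra_simps)
qed (simp add: W.I_zero)

lemma euler_normal_homogeneous_deriv:
  assumes "s \<in> carrier (free_algebra deriv_gens)" "\<forall>w\<in>Poly_Mapping.keys s. length w = n"
  shows "s * euler_normal_poly p - const (p ^ n) * euler_normal_poly p * s \<in> W.I q"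
  using assms
proof (induction s rule: homogeneous_induct)
  case (word w c)
  have "const c * word w * euler_normal_poly p - const (p ^ n) * euler_normal_poly p * (const c * word w)
      = const c * (word w * euler_normal_poly p - const (p ^ n) * euler_normal_poly p * word w)"
    by (simp only: right_diff_distrib times_const[of "const (p ^ n) * euler_normal_poly p" c]
        flip: mult.assoc)
  then show ?case
    using W.I_lmult[OF euler_normal_deriv_word[OF word(1)], of "const c"] word(2) by simp
next
  case (add s t)
  then show ?case using W.I_add[OF add] by (simp add: algebra_simps)
qed (simp add: W.I_zero)

text \<open>By \<open>p ^ n = 1 + (p - 1) * q_bracket p n\<close> the relation for
  \<open>euler_normal_poly\<close> is \<open>p - 1\<close> times this one. An ideal absorbs
  constants, so multiplying by \<open>const (inverse (p - 1))\<close> cancels the factor without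
  leaving it.\<close>

lemma euler_homogeneous:
  assumes p1: "p \<noteq> 1"
    and s: "s \<in> carrier (free_algebra coord_gens)" "\<forall>w\<in>Poly_Mapping.keys s. length w = n"
  shows "euler_poly * s - (const (q_bracket p n) * s + const (p ^ n) * (s * euler_poly)) \<in> W.I q"
    (is "?Y \<in> _")
proof -
  have pn: "p ^ n = 1 + (p - 1) * q_bracket p n"
    using p1 by (simp add: q_bracket_def)
  have "euler_normal_poly p * s - const (p ^ n) * s * euler_normal_poly p =
      s + const (p - 1) * (euler_poly * s) - const (p ^ n) * s
      - const (p ^ n) * ((s * const (p - 1)) * euler_poly)"
    by (simp only: euler_normal_poly_def distrib_left distrib_right mult_1_left mult_1_right
        mult.assoc diff_diff_eq)
  also have "\<dots> = const (p - 1) * ?Y"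
    unfolding times_const[of s]
    by (simp only: right_diff_distrib distrib_left const_mult_letter mult.commute[of "p - 1"] mult.assoc)
       (simp add: pn const_simps algebra_simps)
  finally have X: "euler_normal_poly p * s - const (p ^ n) * s * euler_normal_poly p = const (p - 1) * ?Y" .
  have "?Y = const (inverse (p - 1)) * (const (p - 1) * ?Y)"
    using p1 by (simp only: const_mult_letter) (simp add: const_simps)
  then show ?thesis
    unfolding X[symmetric]
    using W.I_lmult[OF euler_normal_homogeneous[OF s], of "const (inverse (p - 1))"] by simp
qed

lemma euler_homogeneous_deriv:
  assumes p1: "p \<noteq> 1"
    and s: "s \<in> carrier (free_algebra deriv_gens)" "\<forall>w\<in>Poly_Mapping.keys s. length w = n"
  shows "s * euler_poly - (const (q_bracket p n) * s + const (p ^ n) * (euler_poly * s)) \<in> W.I q"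
    (is "?Y \<in> _")
proof -
  have pn: "p ^ n = 1 + (p - 1) * q_bracket p n"
    using p1 by (simp add: q_bracket_def)
  have "s * euler_normal_poly p - const (p ^ n) * euler_normal_poly p * s =
      s + (s * const (p - 1)) * euler_poly - const (p ^ n) * s
      - const (p ^ n) * (const (p - 1) * (euler_poly * s))"
    by (simp only: euler_normal_poly_def distrib_left distrib_right mult_1_left mult_1_right
        mult.assoc diff_diff_eq)
  also have "\<dots> = const (p - 1) * ?Y"
    unfolding times_const[of s]
    by (simp only: right_diff_distrib distrib_left const_mult_letter mult.commute[of "p - 1"] mult.assoc)
       (simp add: pn const_simps algebra_simps)
  finally have X: "s * euler_normal_poly p - const (p ^ n) * euler_normal_poly p * s = const (p - 1) * ?Y" .
  have "?Y = const (inverse (p - 1)) * (const (p - 1) * ?Y)"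
    using p1 by (simp only: const_mult_letter) (simp add: const_simps)
  then show ?thesis
    unfolding X[symmetric]
    using W.I_lmult[OF euler_normal_homogeneous_deriv[OF s], of "const (inverse (p - 1))"] by simp
qed

text \<open>For coordinates \<open>c = p\<close>. For derivatives the known rule has
  \<open>euler_normal_poly\<close> on the other side and must be solved for it, which gives
  \<open>c = inverse p\<close>. That \<open>c\<close> is nonzero allows the rule to be read in both
  directions.\<close>

lemma euler_normal_twist:
  obtains c where "c \<noteq> 0" "euler_normal_poly p * letter g - const c * letter g * euler_normal_poly p \<in> W.I q"
proof (cases "g \<in> coord_gens")
  case True
  then show ?thesis
    using that[of p] euler_normal_coord[OF q0 p_def refl] q0 p_def by auto
next
  case False
  then have "g \<in> deriv_gens" by (cases g) auto
  have p: "p \<noteq> 0" using q0 p_def by simp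
  have "euler_normal_poly p * letter g - const (inverse p) * letter g * euler_normal_poly p =
      const (- inverse p) * (letter g * euler_normal_poly p - const p * euler_normal_poly p * letter g)"
    using p by (simp only: right_diff_distrib const_mult_letter mult.assoc) (simp add: const_simps)
  also have "\<dots> \<in> W.I q"
    using W.I_lmult[OF euler_normal_deriv[OF q0 p_def refl \<open>g \<in> deriv_gens\<close>]] by simp
  finally show ?thesis using that[of "inverse p"] p by simp
qed

text \<open>One of the two inclusions behind normality. The element \<open>t\<close> is
  \<open>s\<close> with each letter rescaled by its twist; an existential suffices, so no
  automorphism of the algebra has to be constructed.\<close>

lemma euler_normal_left: "\<exists>t. euler_normal_poly p * s - t * euler_normal_poly p \<in> W.I q"
proof -
  have "s \<in> carrier (free_algebra UNIV)" by simp
  then show ?thesis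
  proof (induction s rule: free_algebra_induct)
    case (add s s')
    then obtain t t' where "euler_normal_poly p * s - t * euler_normal_poly p \<in> W.I q"
      "euler_normal_poly p * s' - t' * euler_normal_poly p \<in> W.I q" by blast
    from W.I_add[OF this] show ?case
      by (intro exI[of _ "t + t'"]) (simp add: algebra_simps)
  next
    case (const c)
    show ?case by (intro exI[of _ "const c"]) (simp add: times_const[of "euler_normal_poly p"] W.I_zero)
  next
    case (letter g s)
    then obtain t where t: "euler_normal_poly p * s - t * euler_normal_poly p \<in> W.I q" by blast
    obtain c where c: "euler_normal_poly p * letter g - const c * letter g * euler_normal_poly p \<in> W.I q"
      using euler_normal_twist by blast
    have "euler_normal_poly p * (letter g * s) - (const c * letter g * t) * euler_normal_poly p =
      (euler_normal_poly p * letter g - const c * letter g * euler_normal_poly p) * s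
      + const c * letter g * (euler_normal_poly p * s - t * euler_normal_poly p)"
      by (simp add: algebra_simps)
    moreover have "\<dots> \<in> W.I q"
      using c t by (intro W.I_add W.I_lmult W.I_rmult) auto
    ultimately show ?case by metis
  qed
qed

text \<open>The opposite inclusion, with the twist of each letter inverted; hence the factor
  \<open>inverse c\<close> in the witness.\<close>

lemma euler_normal_right: "\<exists>t. s * euler_normal_poly p - euler_normal_poly p * t \<in> W.I q"
proof -
  have "s \<in> carrier (free_algebra UNIV)" by simp
  then show ?thesis
  proof (induction s rule: free_algebra_induct)
    case (add s s')
    then obtain t t' where "s * euler_normal_poly p - euler_normal_poly p * t \<in> W.I q"
      "s' * euler_normal_poly p - euler_normal_poly p * t' \<in> W.I q" by blast
    from W.I_add[OF this] show ?case
      by (intro exI[of _ "t + t'"]) (simp add: algebra_simps)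
  next
    case (const c)
    show ?case by (intro exI[of _ "const c"]) (simp add: times_const[of "euler_normal_poly p"] W.I_zero)
  next
    case (letter g s)
    then obtain t where t: "s * euler_normal_poly p - euler_normal_poly p * t \<in> W.I q" by blast
    obtain c where c0: "c \<noteq> 0"
      and c: "euler_normal_poly p * letter g - const c * letter g * euler_normal_poly p \<in> W.I q"
      using euler_normal_twist by blast
    have "(letter g * s) * euler_normal_poly p - euler_normal_poly p * (const (inverse c) * letter g * t) =
      letter g * (s * euler_normal_poly p - euler_normal_poly p * t)
      - const (inverse c) * ((euler_normal_poly p * letter g - const c * letter g * euler_normal_poly p) * t)"
      using c0 times_const[of "euler_normal_poly p" "inverse c"]
      by (simp only: right_diff_distrib left_diff_distrib const_mult_letter flip: mult.assoc)
         (simp add: const_simps)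
    moreover have "\<dots> \<in> W.I q"
      by (simp only: c t W.I_diff W.I_lmult W.I_rmult carrier_free_UNIV UNIV_I)
    ultimately show ?case by metis
  qed
qed

end

section \<open>Normal forms in the coordinate algebra\<close>

fun monomial :: "idx \<Rightarrow> gen ncpoly" where
  "monomial (e, a, b) = (if e then letter Gtheta else 1) * letter Gx ^ a * letter Gy ^ b"

definition expand :: "(idx \<Rightarrow>\<^sub>0 complex) \<Rightarrow> gen ncpoly" where
  "expand = lin monomial"

text \<open>Evaluation on the basis vector of 1. Being given by \<open>rep\<close>, it is linear,
  turns left multiplication by a letter into an operator, and respects the relations as soon as
  \<open>rep\<close> does.\<close>

definition normal_form :: "complex \<Rightarrow> gen ncpoly \<Rightarrow> (idx \<Rightarrow>\<^sub>0 complex)" where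
  "normal_form q s = rep (basis_op q) s (Poly_Mapping.single (False, 0, 0) 1)"

lemma monomial_closed: "monomial i \<in> carrier (free_algebra coord_gens)"
  by (cases i) (auto intro!: free_closed)

lemma expand_single: "expand (Poly_Mapping.single i c) = const c * monomial i"
  by (simp add: expand_def const_times)

lemma expand_add: "expand (u + v) = expand u + expand v"
  by (simp add: expand_def lin_add)

lemma expand_scl: "expand (scl c v) = const c * expand v"
  by (simp add: expand_def lin_scl const_times)

lemma expand_zero [simp]: "expand 0 = 0"
  by (simp add: expand_def)

lemma expand_closed: "expand v \<in> carrier (free_algebra coord_gens)"
  by (induction v rule: poly_mapping_induct_sum)
     (auto simp: expand_single expand_add intro!: free_closed monomial_closed)

lemma coord_rel_in_ideal:
  "letter Gx * letter Gy - letter Gy * letter Gx \<in> A.I q"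
  "letter Gx * letter Gtheta - const q * letter Gtheta * letter Gx \<in> A.I q"
  "letter Gy * letter Gtheta - const q * letter Gtheta * letter Gy \<in> A.I q"
  "letter Gtheta * letter Gtheta \<in> A.I q"
  by (rule A.rel_in_ideal, simp only: coord_rels_def Let_def insert_iff refl simp_thms)+

lemma y_x_power: "letter Gy * letter Gx ^ a - letter Gx ^ a * letter Gy \<in> A.I q"
proof (induction a)
  case 0
  show ?case by (simp add: A.I_zero)
next
  case (Suc a)
  have "letter Gy * letter Gx ^ Suc a - letter Gx ^ Suc a * letter Gy =
      (letter Gy * letter Gx ^ a - letter Gx ^ a * letter Gy) * letter Gx
      - letter Gx ^ a * (letter Gx * letter Gy - letter Gy * letter Gx)"
    by (simp only: power_Suc2 left_diff_distrib right_diff_distrib mult.assoc) simp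
  also have "\<dots> \<in> A.I q"
    using Suc coord_rel_in_ideal(1)
    by (intro A.I_diff[OF A.I_rmult[OF Suc] A.I_lmult[OF coord_rel_in_ideal(1)]] free_closed) auto
  finally show ?case .
qed

text \<open>For coordinate letters \<open>basis_op\<close> is left multiplication followed by
  reordering: \<open>Gx\<close> and \<open>Gy\<close> cross a possible \<open>Gtheta\<close>,
  \<open>Gy\<close> also crosses the power of \<open>Gx\<close>, and a second \<open>Gtheta\<close>
  gives 0.\<close>

lemma letter_times_monomial:
  assumes "g \<in> coord_gens"
  shows "letter g * monomial i - expand (basis_op q g i) \<in> A.I q"
proof -
  let ?x = "letter Gx" and ?y = "letter Gy" and ?t = "letter Gtheta"
  have cl: "?x \<in> carrier A.F" "?y \<in> carrier A.F" "?t \<in> carrier A.F"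
    by (auto intro!: free_closed)
  obtain e a b where i: "i = (e, a, b)" by (cases i)
  have yx: "(?y * ?x ^ a - ?x ^ a * ?y) * ?y ^ b \<in> A.I q"
    by (intro A.I_rmult y_x_power free_closed cl)
  consider "g = Gx" "e" | "g = Gx" "\<not> e" | "g = Gy" "e" | "g = Gy" "\<not> e"
    | "g = Gtheta" "e" | "g = Gtheta" "\<not> e"
    using assms by auto
  then show ?thesis
  proof cases
    case 1
    have "?x * (?t * ?x ^ a * ?y ^ b) - const q * (?t * ?x ^ Suc a * ?y ^ b) =
        (?x * ?t - const q * ?t * ?x) * (?x ^ a * ?y ^ b)"
      by (simp only: power_Suc left_diff_distrib mult.assoc)
    also have "\<dots> \<in> A.I q"
      by (intro A.I_rmult coord_rel_in_ideal free_closed cl)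
    finally show ?thesis using 1 by (simp add: i expand_single)
  next
    case 2
    then show ?thesis by (simp add: i expand_single const_simps A.I_zero mult.assoc)
  next
    case 3
    have "?y * (?t * ?x ^ a * ?y ^ b) - const q * (?t * ?x ^ a * ?y ^ Suc b) =
        (?y * ?t - const q * ?t * ?y) * (?x ^ a * ?y ^ b)
        + const q * ?t * ((?y * ?x ^ a - ?x ^ a * ?y) * ?y ^ b)"
      by (simp only: power_Suc left_diff_distrib right_diff_distrib mult.assoc) simp
    also have "\<dots> \<in> A.I q"
      by (intro A.I_add A.I_rmult[OF coord_rel_in_ideal(3)] A.I_lmult[OF yx] free_closed cl)
    finally show ?thesis using 3 by (simp add: i expand_single)
  next
    case 4
    have "?y * (?x ^ a * ?y ^ b) - ?x ^ a * ?y ^ Suc b = (?y * ?x ^ a - ?x ^ a * ?y) * ?y ^ b"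
      by (simp only: power_Suc left_diff_distrib mult.assoc)
    then show ?thesis using 4 yx by (simp add: i expand_single const_simps)
  next
    case 5
    have "?t * (?t * ?x ^ a * ?y ^ b) = (?t * ?t) * (?x ^ a * ?y ^ b)"
      by (simp only: mult.assoc)
    also have "\<dots> \<in> A.I q"
      by (intro A.I_rmult coord_rel_in_ideal free_closed cl)
    finally show ?thesis using 5 by (simp add: i)
  next
    case 6
    then show ?thesis by (simp add: i expand_single const_simps A.I_zero mult.assoc)
  qed
qed

lemma letter_times_expand:
  assumes g: "g \<in> coord_gens"
  shows "letter g * expand v - expand (lin (basis_op q g) v) \<in> A.I q"
proof (induction v rule: poly_mapping_induct_sum)
  case (single i c)
  have "letter g * expand (Poly_Mapping.single i c) - expand (lin (basis_op q g) (Poly_Mapping.single i c))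
      = const c * (letter g * monomial i - expand (basis_op q g i))"
    by (simp only: expand_single lin_single expand_scl const_mult_letter right_diff_distrib)
  also have "\<dots> \<in> A.I q"
    by (intro A.I_lmult letter_times_monomial g free_closed)
  finally show ?case .
next
  case (add u v)
  then show ?case using A.I_add[OF add] by (simp add: lin_add expand_add algebra_simps)
qed

text \<open>The spanning half of the basis property, by induction on left multiplication: modulo the
  ideal, \<open>expand\<close> intertwines the operators of the coordinate letters with
  multiplication.\<close>

lemma expand_normal_form:
  assumes "s \<in> carrier (free_algebra coord_gens)"
  shows "s - expand (normal_form q s) \<in> A.I q"
  using assms
proof (induction s rule: free_algebra_induct)
  case (add s t)
  show ?case using A.I_add[OF add(3,4)]
    by (simp add: normal_form_def rep_add expand_add algebra_simps)
next
  case (const c)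
  show ?case by (simp add: normal_form_def rep_const expand_single A.I_zero)
next
  case (letter g s)
  let ?v = "normal_form q s"
  have "letter g * s - expand (normal_form q (letter g * s)) =
      letter g * (s - expand ?v) + (letter g * expand ?v - expand (lin (basis_op q g) ?v))"
    by (simp add: normal_form_def rep_times rep_letter right_diff_distrib)
  also have "\<dots> \<in> A.I q"
    using letter by (intro A.I_add A.I_lmult letter_times_expand free_closed)
  finally show ?case .
qed

lemma rep_letter_power:
  "rep \<omega> (letter g ^ n) v = (lin (\<omega> g) ^^ n) v"
  by (induction n) (simp_all add: rep_one rep_times rep_letter)

text \<open>The powers of y act before those of x, and \<theta> acts last, so the flag
  \<open>e\<close> stays \<open>False\<close> until the end and no factor \<open>q\<close>
  appears.\<close>

lemma normal_form_monomial: "normal_form q (monomial i) = Poly_Mapping.single i 1"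
proof -
  obtain e a b where i: "i = (e, a, b)" by (cases i)
  have y: "(lin (basis_op q Gy) ^^ b) (Poly_Mapping.single (False, 0, 0) 1) = Poly_Mapping.single (False, 0, b) 1"
    by (induction b) simp_all
  have x: "(lin (basis_op q Gx) ^^ a) (Poly_Mapping.single (False, 0, b) 1) = Poly_Mapping.single (False, a, b) 1"
    by (induction a) simp_all
  show ?thesis
    by (simp add: i normal_form_def rep_times rep_letter_power rep_letter rep_one x y)
qed

text \<open>The independence half of the basis property. It is also what makes the transported
  operators compose correctly: between two of them, \<open>expand\<close> followed by
  \<open>normal_form\<close> disappears.\<close>

lemma normal_form_expand: "normal_form q (expand v) = v"
proof (induction v rule: poly_mapping_induct_sum)
  case (single i c)
  have "normal_form q (expand (Poly_Mapping.single i c)) = scl c (normal_form q (monomial i))"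
    by (simp add: expand_single normal_form_def rep_times rep_const)
  then show ?case by (simp add: normal_form_monomial)
next
  case (add u v)
  then show ?case by (simp add: expand_add normal_form_def rep_add)
qed

section \<open>The action of the Weyl algebra\<close>

text \<open>Multiplicativity of \<open>rep\<close> makes the kernel two-sided, so an operator
  identity need only be checked on the generators of the relation ideal.\<close>

lemma rep_kernel_ideal:
  fixes \<omega> :: "'a \<Rightarrow> 'i \<Rightarrow> 'i \<Rightarrow>\<^sub>0 complex"
  shows "ideal {p. \<forall>v. rep \<omega> p v = 0} (free_algebra UNIV)"
proof (rule idealI)
  interpret ring "free_algebra (UNIV :: 'a set)" by (rule ring_free_algebra)
  show "subgroup {p. \<forall>v. rep \<omega> p v = 0} (add_monoid (free_algebra UNIV))"
  proof (rule add.subgroupI, goal_cases)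
    case 2
    show ?case by (auto intro!: exI[of _ 0])
  next
    case (3 a)
    have "\<ominus>\<^bsub>free_algebra UNIV\<^esub> a = - a"
      by (intro minus_equality) auto
    then show ?case using 3 by (auto simp: a_inv_def rep_uminus)
  qed (auto simp: rep_add)
qed (auto simp: ring_free_algebra rep_times)

context
  fixes q :: complex
  assumes q0: "q \<noteq> 0" and q2: "q\<^sup>2 \<noteq> 1"
begin

lemma rep_weyl_ideal:
  assumes "s \<in> W.I q"
  shows "rep (basis_op q) s v = 0"
proof -
  have "W.I q \<subseteq> {s. \<forall>v. rep (basis_op q) s v = 0}"
    using rep_weyl_rels[OF q0 q2] by (intro W.ideal_least rep_kernel_ideal) auto
  then show ?thesis using assms by blast
qed

lemma coord_ideal_subset: "A.I q \<subseteq> W.I q"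
  by (rule relation_ideal_mono) (auto simp: weyl_rels_def A.rels[simplified])

lemma deriv_ideal_subset: "DA.I q \<subseteq> W.I q"
  by (rule relation_ideal_mono) (auto simp: weyl_rels_def DA.rels[simplified])

end

text \<open>The basis operators transported along \<open>normal_form\<close> and
  \<open>expand\<close>. The restricted abstractions supply the extensionality that
  \<open>is_weyl_action\<close> demands.\<close>

definition weyl_act :: "complex \<Rightarrow> gen ncpoly set \<Rightarrow> gen ncpoly set \<Rightarrow> gen ncpoly set" where
  "weyl_act q = (\<lambda>w\<in>carrier (weyl_algebra q). \<lambda>f\<in>carrier (coord_algebra q).
     in_coord q (expand (rep (basis_op q) (SOME a. a \<in> w) (normal_form q (SOME s. s \<in> f)))))"

context
  fixes q :: complex
  assumes q0: "q \<noteq> 0" and q2: "q\<^sup>2 \<noteq> 1"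
begin

lemma rep_weyl_cong:
  assumes "a - b \<in> W.I q"
  shows "rep (basis_op q) a v = rep (basis_op q) b v"
  using rep_weyl_ideal[OF q0 q2 assms, of v] by (simp add: rep_diff)

text \<open>Neither choice matters. Representatives of a Weyl class act equally since
  \<open>rep\<close> kills the relations; for the argument the same reason applies, because
  \<open>normal_form\<close> is itself a value of \<open>rep\<close> and the coordinate ideal lies
  in the Weyl ideal.\<close>

lemma weyl_act_eq:
  assumes s: "s \<in> carrier (free_algebra coord_gens)"
  shows "weyl_act q (in_weyl q a) (in_coord q s) =
         in_coord q (expand (rep (basis_op q) a (normal_form q s)))"
proof -
  have "a \<in> in_weyl q a" by (simp add: W.mem_pi_iff W.I_zero)
  then have "(SOME a'. a' \<in> in_weyl q a) \<in> in_weyl q a" by (rule someI)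
  then have a: "rep (basis_op q) (SOME a'. a' \<in> in_weyl q a) v = rep (basis_op q) a v" for v
    by (intro rep_weyl_cong) (simp add: W.mem_pi_iff)
  have "s \<in> in_coord q s" using s by (simp add: A.mem_pi_iff A.I_zero)
  then have "(SOME s'. s' \<in> in_coord q s) \<in> in_coord q s" by (rule someI)
  then have "normal_form q (SOME s'. s' \<in> in_coord q s) = normal_form q s"
    using s coord_ideal_subset[OF q0 q2] unfolding normal_form_def
    by (intro rep_weyl_cong) (auto simp: A.mem_pi_iff)
  then show ?thesis
    using s a by (simp add: weyl_act_def W.pi_closed A.pi_closed)
qed

lemma in_coord_normal_form:
  assumes "s \<in> carrier (free_algebra coord_gens)"
  shows "in_coord q (expand (normal_form q s)) = in_coord q s"
  using A.pi_eq_iff[OF assms expand_closed] expand_normal_form[OF assms] by metis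

lemma is_weyl_action_weyl_act: "is_weyl_action q (weyl_act q)"
  unfolding is_weyl_action_def Let_def
proof (intro conjI ballI allI, goal_cases)
  case 1
  show ?case
  proof (rule PiE_I)
    fix w assume "w \<in> carrier (weyl_algebra q)"
    then obtain a where "w = in_weyl q a" using W.pi_surj by blast
    then show "weyl_act q w \<in> carrier (coord_algebra q) \<rightarrow>\<^sub>E carrier (coord_algebra q)"
      by (auto simp: weyl_act_def W.pi_closed intro!: A.pi_closed expand_closed)
  qed (simp add: weyl_act_def)
next
  case (2 w f g)
  then obtain a s t where "w = in_weyl q a" "f = in_coord q s" "g = in_coord q t"
    "s \<in> carrier (free_algebra coord_gens)" "t \<in> carrier (free_algebra coord_gens)"
    using W.pi_surj A.pi_surj by meson
  then show ?case
    by (simp add: A.pi_add weyl_act_eq free_closed normal_form_def rep_add rep_add_right expand_add expand_closed)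
next
  case (3 v w f)
  then obtain a b s where "v = in_weyl q a" "w = in_weyl q b" "f = in_coord q s"
    "s \<in> carrier (free_algebra coord_gens)"
    using W.pi_surj A.pi_surj by meson
  then show ?case
    by (simp add: A.pi_add W.pi_add weyl_act_eq rep_add expand_add expand_closed)
next
  case (4 v w f)
  then obtain a b s where "v = in_weyl q a" "w = in_weyl q b" "f = in_coord q s"
    "s \<in> carrier (free_algebra coord_gens)"
    using W.pi_surj A.pi_surj by meson
  then show ?case
    by (simp add: W.pi_mult weyl_act_eq rep_times expand_closed normal_form_expand)
next
  case (5 c f)
  then obtain s where "f = in_coord q s" "s \<in> carrier (free_algebra coord_gens)"
    using A.pi_surj by meson
  then show ?case
    by (simp add: weyl_act_eq rep_const expand_scl in_coord_normal_form A.pi_mult[symmetric] free_closed expand_closed)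
next
  case (6 g f)
  then obtain s where s: "f = in_coord q s" "s \<in> carrier (free_algebra coord_gens)"
    using A.pi_surj by meson
  have c: "letter g * s \<in> carrier (free_algebra coord_gens)"
    using 6 s by (intro free_closed) auto
  \<comment> \<open>Both sides let \<open>letter g * s\<close> act on the basis vector of 1.\<close>
  have "rep (basis_op q) (letter g) (normal_form q s) = normal_form q (letter g * s)"
    by (simp add: normal_form_def rep_times)
  then show ?case
    using 6 s c by (simp only: weyl_act_eq in_coord_normal_form A.pi_mult free_closed)
next
  case (7 g)
  then have "rep (basis_op q) (letter g) (normal_form q 1) = 0"
    by (auto simp: normal_form_def rep_one rep_letter)
  then show ?case
    by (simp add: A.pi_one A.pi_zero weyl_act_eq free_closed)
qed

end

section \<open>Uniqueness of the action\<close>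

lemma weyl_actionD:
  assumes "is_weyl_action q \<rho>"
  shows "\<rho> \<in> carrier (weyl_algebra q) \<rightarrow>\<^sub>E (carrier (coord_algebra q) \<rightarrow>\<^sub>E carrier (coord_algebra q))"
    and "h \<in> deriv_gens \<Longrightarrow> \<rho> (in_weyl q (letter h)) \<one>\<^bsub>coord_algebra q\<^esub> = \<zero>\<^bsub>coord_algebra q\<^esub>"
    and "f \<in> carrier (coord_algebra q) \<Longrightarrow> \<rho> (in_weyl q a) f \<in> carrier (coord_algebra q)"
    and "f \<in> carrier (coord_algebra q) \<Longrightarrow> g \<in> carrier (coord_algebra q) \<Longrightarrow>
      \<rho> (in_weyl q a) (f \<oplus>\<^bsub>coord_algebra q\<^esub> g) = \<rho> (in_weyl q a) f \<oplus>\<^bsub>coord_algebra q\<^esub> \<rho> (in_weyl q a) g"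
    and "f \<in> carrier (coord_algebra q) \<Longrightarrow>
      \<rho> (in_weyl q (a + b)) f = \<rho> (in_weyl q a) f \<oplus>\<^bsub>coord_algebra q\<^esub> \<rho> (in_weyl q b) f"
    and "f \<in> carrier (coord_algebra q) \<Longrightarrow> \<rho> (in_weyl q (a * b)) f = \<rho> (in_weyl q a) (\<rho> (in_weyl q b) f)"
    and "f \<in> carrier (coord_algebra q) \<Longrightarrow>
      \<rho> (in_weyl q (const c)) f = in_coord q (const c) \<otimes>\<^bsub>coord_algebra q\<^esub> f"
    and "f \<in> carrier (coord_algebra q) \<Longrightarrow> k \<in> coord_gens \<Longrightarrow>
      \<rho> (in_weyl q (letter k)) f = in_coord q (letter k) \<otimes>\<^bsub>coord_algebra q\<^esub> f"
proof -
  have w: "in_weyl q a \<in> carrier (weyl_algebra q)" for a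
    by (rule W.pi_closed) simp
  note A = assms[unfolded is_weyl_action_def Let_def]
  note A1 = A[THEN conjunct1] and A = A[THEN conjunct2]
  note A2 = A[THEN conjunct1] and A = A[THEN conjunct2]
  note A3 = A[THEN conjunct1] and A = A[THEN conjunct2]
  note A4 = A[THEN conjunct1] and A = A[THEN conjunct2]
  note A5 = A[THEN conjunct1] and A = A[THEN conjunct2]
  note A6 = A[THEN conjunct1] and A7 = A[THEN conjunct2]
  show "\<rho> \<in> carrier (weyl_algebra q) \<rightarrow>\<^sub>E (carrier (coord_algebra q) \<rightarrow>\<^sub>E carrier (coord_algebra q))"
    by (rule A1)
  show "h \<in> deriv_gens \<Longrightarrow> \<rho> (in_weyl q (letter h)) \<one>\<^bsub>coord_algebra q\<^esub> = \<zero>\<^bsub>coord_algebra q\<^esub>"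
    by (rule A7[rule_format])
  assume f: "f \<in> carrier (coord_algebra q)"
  show "\<rho> (in_weyl q a) f \<in> carrier (coord_algebra q)"
    by (rule PiE_mem[OF PiE_mem[OF A1 w] f])
  show "\<rho> (in_weyl q (a + b)) f = \<rho> (in_weyl q a) f \<oplus>\<^bsub>coord_algebra q\<^esub> \<rho> (in_weyl q b) f"
    using A3[rule_format, OF w w f, of a b] by (simp only: W.pi_add carrier_free_UNIV UNIV_I)
  show "\<rho> (in_weyl q (a * b)) f = \<rho> (in_weyl q a) (\<rho> (in_weyl q b) f)"
    using A4[rule_format, OF w w f, of a b] by (simp only: W.pi_mult carrier_free_UNIV UNIV_I)
  show "\<rho> (in_weyl q (const c)) f = in_coord q (const c) \<otimes>\<^bsub>coord_algebra q\<^esub> f"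
    by (rule A5[rule_format, OF f])
  show "k \<in> coord_gens \<Longrightarrow> \<rho> (in_weyl q (letter k)) f = in_coord q (letter k) \<otimes>\<^bsub>coord_algebra q\<^esub> f"
    by (rule A6[rule_format, OF _ f])
  assume g: "g \<in> carrier (coord_algebra q)"
  show "\<rho> (in_weyl q a) (f \<oplus>\<^bsub>coord_algebra q\<^esub> g) = \<rho> (in_weyl q a) f \<oplus>\<^bsub>coord_algebra q\<^esub> \<rho> (in_weyl q a) g"
    by (rule A2[rule_format, OF w f g])
qed

text \<open>
  The cross relations move a derivative past a coordinate, so two actions that agree on
  \<open>f\<close> for all derivatives also agree on \<open>x f\<close>, \<open>y f\<close> and \<open>\<theta> f\<close>.
\<close>

lemma weyl_action_unique:
  assumes q0: "q \<noteq> 0" and \<rho>: "is_weyl_action q \<rho>" and \<rho>': "is_weyl_action q \<rho>'"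
  shows "\<rho> = \<rho>'"
proof -
  let ?A = "coord_algebra q" and ?C = "carrier (coord_algebra q)" and ?w = "in_weyl q"
  \<comment> \<open>Renumbered: 1 is the type of the action, 2 closure, 3 additivity in the
    argument, 4 and 5 sums and products of operators, 6 constants, 7 coordinate letters, 8
    annihilation of 1.\<close>
  note D = weyl_actionD(1,3-8,2)
  \<comment> \<open>For fixed \<open>f\<close>, agreement is preserved by sums, by left
    multiplication with constants and coordinates, and modulo the ideal. Left multiplication by a
    derivative is the one operation missing from this list, since it needs agreement at a different
    argument.\<close>
  define G where "G f a \<longleftrightarrow> f \<in> ?C \<and> \<rho> (?w a) f = \<rho>' (?w a) f" for f a
  have G_add: "G f (a + b)" if "G f a" "G f b" for f a b
    using that D(4)[OF \<rho>] D(4)[OF \<rho>'] by (simp add: G_def)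
  have G_coord: "G f (letter h * a)" if "h \<in> coord_gens" "G f a" for f a h
    using that D(2,5,7)[OF \<rho>] D(2,5,7)[OF \<rho>'] by (simp add: G_def)
  have G_const: "G f (const c * a)" if "G f a" for f a c
    using that D(2,5,6)[OF \<rho>] D(2,5,6)[OF \<rho>'] by (simp add: G_def)
  have G_c: "G f (const c)" if "f \<in> ?C" for f c
    using that D(6)[OF \<rho>] D(6)[OF \<rho>'] by (simp add: G_def)
  have G_1: "G f 1" if "f \<in> ?C" for f
    using G_c[OF that, of 1] by (simp add: const_simps)
  have G_uminus: "G f (- a)" if "G f a" for f a
    using G_const[OF that, of "- 1"] by (simp add: const_simps)
  have G_cong: "G f a" if "a - b \<in> W.I q" "G f b" for f a b
    using that W.pi_eq_iff[of a b q] by (simp add: G_def)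
  have G_cross: "G f (letter g * letter h)"
    if g: "g \<in> deriv_gens" and h: "h \<in> coord_gens" and f: "f \<in> ?C"
      and G: "\<forall>g\<in>deriv_gens. G f (letter g)" for f g h
  proof -
    note rels = weyl_rel_in_ideal[OF q0 refl refl]
    have G': "G f (letter Dx)" "G f (letter Dy)" "G f (letter Dtheta)"
      using G by auto
    have G2: "G f (letter h * a)" "G f (const c * letter h * a)"
      if "h \<in> coord_gens" "G f a" for h a c
      using that G_coord G_const by (simp_all add: mult.assoc)
    have G3: "G f (a - b)" if "G f a" "G f b" for a b
      using G_add[OF that(1) G_uminus[OF that(2)]] by simp
    have mem: "Gx \<in> coord_gens" "Gy \<in> coord_gens" "Gtheta \<in> coord_gens" by auto
    note intros = G_add G3 G2 G_const G' G_1[OF f] mem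
    have "G f (letter Dx * letter Gx)"
      by (rule G_cong[OF rels(5)], intro intros)
    moreover
    have "G f (letter Dy * letter Gx)"
      by (rule G_cong[OF rels(6)], intro intros)
    moreover
    have "G f (letter Dtheta * letter Gx)"
      by (rule G_cong[OF rels(7)], intro intros)
    moreover
    have "G f (letter Dy * letter Gy)"
      by (rule G_cong[OF rels(8)], intro intros)
    moreover
    have "G f (letter Dx * letter Gy)"
      by (rule G_cong[OF rels(9)], intro intros)
    moreover
    have "G f (letter Dtheta * letter Gy)"
      by (rule G_cong[OF rels(10)], intro intros)
    moreover
    have "G f (letter Dtheta * letter Gtheta)"
      by (rule G_cong[OF rels(11)], intro intros)
    moreover
    have "G f (letter Dx * letter Gtheta)"
      by (rule G_cong[OF rels(12)], intro intros)
    moreover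
    have "G f (letter Dy * letter Gtheta)"
      by (rule G_cong[OF rels(13)], intro intros)
    ultimately show ?thesis using g h by blast
  qed
  have G_deriv: "\<forall>g\<in>deriv_gens. G (in_coord q s) (letter g)"
    if "s \<in> carrier (free_algebra coord_gens)" for s
    using that
  proof (induction s rule: free_algebra_induct)
    case (add s t)
    then show ?case
      using A.pi_add[of s t q] A.pi_closed[of _ q] D(3)[OF \<rho>] D(3)[OF \<rho>'] 
      by (auto simp: G_def simp flip: A.pi_add)
  next
    case (const c)
    have c: "in_coord q (const c) = \<sigma> (?w (const c)) \<one>\<^bsub>?A\<^esub>" if "is_weyl_action q \<sigma>" for \<sigma>
      using D(6)[OF that A.Q.one_closed] A.pi_closed[OF free_closed(3)] by simp
    have zero: "\<sigma> (?w (letter g)) (in_coord q (const c)) = \<zero>\<^bsub>?A\<^esub>"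
      if "is_weyl_action q \<sigma>" "g \<in> deriv_gens" for g \<sigma>
    proof -
      \<comment> \<open>The class of a constant is that constant applied to 1; constants are
        central, so the derivative can be made to act on 1 first.\<close>
      have "\<sigma> (?w (letter g)) (in_coord q (const c)) = \<sigma> (?w (const c * letter g)) \<one>\<^bsub>?A\<^esub>"
        using c[OF that(1)] D(5)[OF that(1) A.Q.one_closed] times_const[of "letter g" c] by metis
      also have "\<dots> = \<zero>\<^bsub>?A\<^esub>"
        using D(5,6,8)[OF that(1)] that(2) A.pi_closed[OF free_closed(3), of q c] by simp
      finally show ?thesis .
    qed
    show ?case
      using zero[OF \<rho>] zero[OF \<rho>'] A.pi_closed[OF free_closed(3)] by (metis G_def)
  next
    case (letter h s)
    let ?f = "in_coord q s"
    have f: "?f \<in> ?C" using letter by (intro A.pi_closed)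
    have hs: "in_coord q (letter h * s) = \<sigma> (?w (letter h)) ?f" if "is_weyl_action q \<sigma>" for \<sigma>
      using D(7)[OF that f letter(1)] A.pi_mult[OF free_closed(4)[OF letter(1)] letter(2)] by simp
    show ?case
    proof
      fix g assume "g \<in> deriv_gens"
      then have "G ?f (letter g * letter h)"
        using G_cross letter f by blast
      then have "\<rho> (?w (letter g)) (\<rho> (?w (letter h)) ?f) = \<rho>' (?w (letter g)) (\<rho>' (?w (letter h)) ?f)"
        using D(5)[OF \<rho> f] D(5)[OF \<rho>' f] by (simp add: G_def)
      then show "G (in_coord q (letter h * s)) (letter g)"
        using hs[OF \<rho>] hs[OF \<rho>'] D(2)[OF \<rho> f] by (simp add: G_def)
    qed
  qed
  have G_letter: "G f (letter g)" if "f \<in> ?C" for f g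
  proof (cases "g \<in> deriv_gens")
    case True
    then show ?thesis using A.pi_surj[OF that] G_deriv by blast
  next
    case False
    then have "g \<in> coord_gens" by (cases g) auto
    then show ?thesis using G_coord[OF _ G_1[OF that]] by (metis mult.right_neutral)
  qed
  have G_all: "G f a" if f: "f \<in> ?C" for f a
  proof -
    have "a \<in> carrier (free_algebra UNIV)" by simp
    then show ?thesis
    proof (induction a rule: free_algebra_induct)
      \<comment> \<open>The new letter is applied at the argument \<open>\<rho> (?w a) f\<close>
        instead of \<open>f\<close>, which is why \<open>G_letter\<close> is proved for all
        arguments.\<close>
      case (letter g a)
      then show ?case
        using G_letter[of "\<rho> (?w a) f" g] D(2,5)[OF \<rho>] D(2,5)[OF \<rho>'] by (simp add: G_def)
    qed (use f G_add G_c in auto)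
  qed
  show ?thesis
  proof (rule PiE_ext[OF D(1)[OF \<rho>] D(1)[OF \<rho>']])
    fix w assume w: "w \<in> carrier (weyl_algebra q)"
    then obtain a where a: "w = ?w a" using W.pi_surj by blast
    show "\<rho> w = \<rho>' w"
      using PiE_mem[OF D(1)[OF \<rho>] w] PiE_mem[OF D(1)[OF \<rho>'] w] G_all
      by (intro PiE_ext) (auto simp: G_def a)
  qed
qed

lemma is_weyl_action_weyl_action:
  assumes "q \<noteq> 0" "q\<^sup>2 \<noteq> 1"
  shows "is_weyl_action q (weyl_action q)"
  unfolding weyl_action_def
proof (rule theI[of "is_weyl_action q" "weyl_act q"])
  show "is_weyl_action q (weyl_act q)"
    by (rule is_weyl_action_weyl_act[OF assms])
  show "\<rho> = weyl_act q" if "is_weyl_action q \<rho>" for \<rho>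
    by (rule weyl_action_unique[OF assms(1) that is_weyl_action_weyl_act[OF assms]])
qed

section \<open>Normality and the twisted Leibniz rule\<close>

context
  fixes q :: complex
  assumes q0: "q \<noteq> 0" and q2: "q\<^sup>2 \<noteq> 1"
begin

lemma weyl_embed_coord:
  assumes "s \<in> carrier (free_algebra coord_gens)"
  shows "weyl_embed q (in_coord q s) = in_weyl q s"
proof -
  have "in_weyl q t = in_weyl q s" if "t \<in> in_coord q s" for t
    using that assms coord_ideal_subset[OF q0 q2] by (auto simp: A.mem_pi_iff W.pi_eq_iff)
  moreover have "s \<in> in_coord q s"
    using assms by (simp add: A.mem_pi_iff A.I_zero)
  ultimately show ?thesis unfolding weyl_embed_def by blast
qed

lemma weyl_embed_deriv:
  assumes "s \<in> carrier (free_algebra deriv_gens)"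
  shows "weyl_embed q (residue_class deriv_gens (deriv_rels q) s) = in_weyl q s"
proof -
  have "in_weyl q t = in_weyl q s" if "t \<in> residue_class deriv_gens (deriv_rels q) s" for t
    using that assms deriv_ideal_subset[OF q0 q2] by (auto simp: DA.mem_pi_iff W.pi_eq_iff)
  moreover have "s \<in> residue_class deriv_gens (deriv_rels q) s"
    using assms by (simp add: DA.mem_pi_iff DA.I_zero)
  ultimately show ?thesis unfolding weyl_embed_def by blast
qed

lemma euler_eq: "euler q = in_weyl q euler_poly"
  by (simp add: euler_def euler_poly_def)

lemma euler_normal_eq: "euler_normal q = in_weyl q (euler_normal_poly (inverse (q\<^sup>2)))"
  unfolding euler_normal_def euler_eq euler_normal_poly_def q_powi
  by (simp only: W.pi_one W.pi_mult W.pi_add carrier_free_UNIV UNIV_I)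

lemma inverse_square_neq_1: "inverse (q\<^sup>2) \<noteq> 1"
  using q0 q2 by simp

text \<open>Left multiplication is prescribed only for constants and letters; multiplicativity and
  additivity in the operator extend it to all coordinate polynomials.\<close>

lemma weyl_action_coord:
  assumes "is_weyl_action q \<rho>" "s \<in> carrier (free_algebra coord_gens)" "f \<in> carrier (coord_algebra q)"
  shows "\<rho> (in_weyl q s) f = in_coord q s \<otimes>\<^bsub>coord_algebra q\<^esub> f"
  using assms(2)
proof (induction s rule: free_algebra_induct)
  case (add s t)
  then show ?case
    using weyl_actionD(5)[OF assms(1,3)] A.Q.l_distr[OF A.pi_closed A.pi_closed assms(3)]
    by (metis A.pi_add)
next
  case (const c)
  show ?case by (rule weyl_actionD(7)[OF assms(1,3)])
next
  case (letter g s)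
  have "letter g \<in> carrier A.F" using letter(1) by (rule free_closed)
  then show ?case
    using letter weyl_actionD(6)[OF assms(1,3)] weyl_actionD(8)[OF assms(1) _ letter(1)]
      weyl_actionD(3)[OF assms(1,3)] A.Q.m_assoc[OF A.pi_closed A.pi_closed assms(3)]
    by (metis A.pi_mult)
qed

text \<open>Every summand of \<open>euler_poly\<close> has a derivative as its right factor, which
  acts first and kills 1.\<close>

lemma euler_one:
  assumes "is_weyl_action q \<rho>"
  shows "\<rho> (in_weyl q euler_poly) \<one>\<^bsub>coord_algebra q\<^esub> = \<zero>\<^bsub>coord_algebra q\<^esub>"
proof -
  note D = weyl_actionD(5,6,8)[OF assms] and D' = weyl_actionD(2)[OF assms]
  have z: "\<rho> (in_weyl q (letter g * letter h)) \<one>\<^bsub>coord_algebra q\<^esub> = \<zero>\<^bsub>coord_algebra q\<^esub>"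
    if "g \<in> coord_gens" "h \<in> deriv_gens" for g h
    unfolding D(2)[OF A.Q.one_closed] D'[OF that(2)] D(3)[OF A.Q.zero_closed that(1)]
    by (rule A.Q.r_null) (intro A.pi_closed free_closed that)
  show ?thesis
    by (simp add: euler_poly_def D(1) z)
qed

text \<open>The ideal membership behind (i) is an equality of Weyl classes, and both sides are
  applied to \<open>h\<close>. The argument \<open>h\<close> is left general so that it can be 1 as
  well as the second factor of a product.\<close>

lemma euler_act_homogeneous:
  assumes s: "s \<in> carrier (free_algebra coord_gens)" "\<forall>w\<in>Poly_Mapping.keys s. length w = n"
    and \<rho>: "is_weyl_action q \<rho>" and h: "h \<in> carrier (coord_algebra q)"
  shows "\<rho> (in_weyl q euler_poly) (in_coord q s \<otimes>\<^bsub>coord_algebra q\<^esub> h) =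
    in_coord q (const (q_bracket (inverse (q\<^sup>2)) n)) \<otimes>\<^bsub>coord_algebra q\<^esub> (in_coord q s \<otimes>\<^bsub>coord_algebra q\<^esub> h)
    \<oplus>\<^bsub>coord_algebra q\<^esub> in_coord q (const (inverse (q\<^sup>2) ^ n)) \<otimes>\<^bsub>coord_algebra q\<^esub>
      (in_coord q s \<otimes>\<^bsub>coord_algebra q\<^esub> \<rho> (in_weyl q euler_poly) h)"
proof -
  note D = weyl_actionD[OF \<rho>]
  let ?b = "const (q_bracket (inverse (q\<^sup>2)) n)" and ?c = "const (inverse (q\<^sup>2) ^ n)"
  have "in_weyl q (euler_poly * s) = in_weyl q (?b * s + ?c * (s * euler_poly))"
    using euler_homogeneous[OF q0 refl inverse_square_neq_1 s] by (simp add: W.pi_eq_iff)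
  then have "\<rho> (in_weyl q (euler_poly * s)) h = \<rho> (in_weyl q (?b * s + ?c * (s * euler_poly))) h"
    by (rule arg_cong)
  then show ?thesis
    unfolding D(5)[OF h] D(6)[OF h] D(6)[OF D(3)[OF h]] weyl_action_coord[OF \<rho> s(1) h]
      weyl_action_coord[OF \<rho> s(1) D(3)[OF h]]
    using D(7) A.Q.m_closed[OF A.pi_closed[OF s(1)] h] A.Q.m_closed[OF A.pi_closed[OF s(1)] D(3)[OF h]]
    by metis
qed

lemma euler_act_leibniz:
  assumes s: "s \<in> carrier (free_algebra coord_gens)" "\<forall>w\<in>Poly_Mapping.keys s. length w = n"
    and \<rho>: "is_weyl_action q \<rho>" and h: "h \<in> carrier (coord_algebra q)"
  shows "\<rho> (in_weyl q euler_poly) (in_coord q s \<otimes>\<^bsub>coord_algebra q\<^esub> h) =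
    \<rho> (in_weyl q euler_poly) (in_coord q s) \<otimes>\<^bsub>coord_algebra q\<^esub> h \<oplus>\<^bsub>coord_algebra q\<^esub>
    in_coord q (const (inverse (q\<^sup>2) ^ n)) \<otimes>\<^bsub>coord_algebra q\<^esub>
      (in_coord q s \<otimes>\<^bsub>coord_algebra q\<^esub> \<rho> (in_weyl q euler_poly) h)"
proof -
  have f: "in_coord q s \<in> carrier (coord_algebra q)" by (rule A.pi_closed[OF s(1)])
  have c: "in_coord q (const c) \<in> carrier (coord_algebra q)" for c
    by (intro A.pi_closed free_closed)
  \<comment> \<open>With \<open>h\<close> equal to 1 the second summand vanishes, so D acts on a
    homogeneous element as its bracket; this identifies the bracket term of the general formula with
    D(f) h.\<close>
  have "\<rho> (in_weyl q euler_poly) (in_coord q s) =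
      in_coord q (const (q_bracket (inverse (q\<^sup>2)) n)) \<otimes>\<^bsub>coord_algebra q\<^esub> in_coord q s"
    using euler_act_homogeneous[OF s \<rho> A.Q.one_closed] f c by (simp add: euler_one[OF \<rho>])
  then show ?thesis
    using euler_act_homogeneous[OF s \<rho> h] A.Q.m_assoc[OF c f h] by simp
qed

lemma euler_normal_nonzero: "euler_normal q \<noteq> \<zero>\<^bsub>weyl_algebra q\<^esub>"
proof
  let ?one = "Poly_Mapping.single (False, 0, 0) 1 :: idx \<Rightarrow>\<^sub>0 complex"
  assume "euler_normal q = \<zero>\<^bsub>weyl_algebra q\<^esub>"
  then have "euler_normal_poly (inverse (q\<^sup>2)) \<in> W.I q"
    by (simp add: euler_normal_eq W.pi_zero W.pi_eq_iff)
  then have "rep (basis_op q) (euler_normal_poly (inverse (q\<^sup>2))) ?one = 0"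
    by (rule rep_weyl_ideal[OF q0 q2])
  moreover have "rep (basis_op q) (euler_normal_poly (inverse (q\<^sup>2))) ?one = ?one"
    by (simp add: euler_normal_poly_def euler_poly_def rep_add rep_times rep_one rep_const rep_letter)
  moreover have "?one \<noteq> 0"
    by (metis lookup_single_eq lookup_zero zero_neq_one)
  ultimately show False by simp
qed

lemma euler_normal_normal: "normal_element (weyl_algebra q) (euler_normal q)"
proof -
  let ?E = "euler_normal_poly (inverse (q\<^sup>2))"
  have "\<exists>t. in_weyl q (?E * s) = in_weyl q (t * ?E)" "\<exists>t. in_weyl q (s * ?E) = in_weyl q (?E * t)" for s
    using euler_normal_left[OF q0 refl] euler_normal_right[OF q0 refl] by (simp_all add: W.pi_eq_iff)
  moreover have "carrier (weyl_algebra q) = range (in_weyl q)"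
    using W.pi_surj[of _ q] W.pi_closed[of _ q] by auto
  ultimately show ?thesis
    unfolding normal_element_def euler_normal_eq l_coset_def r_coset_def
    by (auto simp: W.pi_mult)
qed

end
theorem theorem4p37:
  fixes q :: complex
  assumes "q \<noteq> 0" and "q\<^sup>2 \<noteq> 1"
  shows
    "let W = weyl_algebra q; A = coord_algebra q;
         D = euler q; act = weyl_action q; E = euler_normal q
     in
     (\<forall>n f. homogeneous coord_gens (coord_rels q) n f \<longrightarrow>
        D \<otimes>\<^bsub>W\<^esub> weyl_embed q f =
          in_weyl q (const (q_bracket (q powi (-2)) n)) \<otimes>\<^bsub>W\<^esub> weyl_embed q f \<oplus>\<^bsub>W\<^esub>
          in_weyl q (const (q powi (- 2 * int n))) \<otimes>\<^bsub>W\<^esub> (weyl_embed q f \<otimes>\<^bsub>W\<^esub> D)) \<and>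
     (\<forall>n g. homogeneous deriv_gens (deriv_rels q) n g \<longrightarrow>
        weyl_embed q g \<otimes>\<^bsub>W\<^esub> D =
          in_weyl q (const (q_bracket (q powi (-2)) n)) \<otimes>\<^bsub>W\<^esub> weyl_embed q g \<oplus>\<^bsub>W\<^esub>
          in_weyl q (const (q powi (- 2 * int n))) \<otimes>\<^bsub>W\<^esub> (D \<otimes>\<^bsub>W\<^esub> weyl_embed q g)) \<and>
     (\<forall>n k f h. homogeneous coord_gens (coord_rels q) n f \<longrightarrow>
        homogeneous coord_gens (coord_rels q) k h \<longrightarrow>
        act D (f \<otimes>\<^bsub>A\<^esub> h) =
          act D f \<otimes>\<^bsub>A\<^esub> h \<oplus>\<^bsub>A\<^esub>
          in_coord q (const (q powi (- 2 * int n))) \<otimes>\<^bsub>A\<^esub> (f \<otimes>\<^bsub>A\<^esub> act D h)) \<and>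
     E \<noteq> \<zero>\<^bsub>W\<^esub> \<and> normal_element W E"
  unfolding Let_def
proof (intro conjI allI impI)
  note euler_eq = euler_eq[OF assms]
  fix n f assume "homogeneous coord_gens (coord_rels q) n f"
  then obtain s where s: "s \<in> carrier (free_algebra coord_gens)" "\<forall>w\<in>Poly_Mapping.keys s. length w = n"
    and f: "f = in_coord q s"
    unfolding homogeneous_def by blast
  show "euler q \<otimes>\<^bsub>weyl_algebra q\<^esub> weyl_embed q f =
      in_weyl q (const (q_bracket (q powi (-2)) n)) \<otimes>\<^bsub>weyl_algebra q\<^esub> weyl_embed q f
      \<oplus>\<^bsub>weyl_algebra q\<^esub> in_weyl q (const (q powi (- 2 * int n))) \<otimes>\<^bsub>weyl_algebra q\<^esub>
        (weyl_embed q f \<otimes>\<^bsub>weyl_algebra q\<^esub> euler q)"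
    using euler_homogeneous[OF assms(1) refl inverse_square_neq_1[OF assms] s]
    unfolding f weyl_embed_coord[OF assms s(1)] euler_eq q_powi
    by (simp only: W.pi_mult W.pi_add W.pi_eq_iff carrier_free_UNIV UNIV_I)
next
  note euler_eq = euler_eq[OF assms]
  fix n g assume "homogeneous deriv_gens (deriv_rels q) n g"
  then obtain s where s: "s \<in> carrier (free_algebra deriv_gens)" "\<forall>w\<in>Poly_Mapping.keys s. length w = n"
    and g: "g = residue_class deriv_gens (deriv_rels q) s"
    unfolding homogeneous_def by blast
  show "weyl_embed q g \<otimes>\<^bsub>weyl_algebra q\<^esub> euler q =
      in_weyl q (const (q_bracket (q powi (-2)) n)) \<otimes>\<^bsub>weyl_algebra q\<^esub> weyl_embed q g
      \<oplus>\<^bsub>weyl_algebra q\<^esub> in_weyl q (const (q powi (- 2 * int n))) \<otimes>\<^bsub>weyl_algebra q\<^esub>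
        (euler q \<otimes>\<^bsub>weyl_algebra q\<^esub> weyl_embed q g)"
    using euler_homogeneous_deriv[OF assms(1) refl inverse_square_neq_1[OF assms] s]
    unfolding g weyl_embed_deriv[OF assms s(1)] euler_eq q_powi
    by (simp only: W.pi_mult W.pi_add W.pi_eq_iff carrier_free_UNIV UNIV_I)
next
  fix n k f h
  assume "homogeneous coord_gens (coord_rels q) n f"
  then obtain s where s: "s \<in> carrier (free_algebra coord_gens)" "\<forall>w\<in>Poly_Mapping.keys s. length w = n"
    and f: "f = in_coord q s"
    unfolding homogeneous_def by blast
  assume "homogeneous coord_gens (coord_rels q) k h"
  then have h: "h \<in> carrier (coord_algebra q)"
    unfolding homogeneous_def using A.pi_closed by blast
  show "weyl_action q (euler q) (f \<otimes>\<^bsub>coord_algebra q\<^esub> h) =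
      weyl_action q (euler q) f \<otimes>\<^bsub>coord_algebra q\<^esub> h \<oplus>\<^bsub>coord_algebra q\<^esub>
      in_coord q (const (q powi (- 2 * int n))) \<otimes>\<^bsub>coord_algebra q\<^esub>
        (f \<otimes>\<^bsub>coord_algebra q\<^esub> weyl_action q (euler q) h)"
    unfolding f euler_eq[OF assms] q_powi
    by (rule euler_act_leibniz[OF assms s is_weyl_action_weyl_action[OF assms] h])
next
  show "euler_normal q \<noteq> \<zero>\<^bsub>weyl_algebra q\<^esub>"
    by (rule euler_normal_nonzero[OF assms])
  show "normal_element (weyl_algebra q) (euler_normal q)"
    by (rule euler_normal_normal[OF assms])
qed

end
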